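(* Let $G$ be a finite simple connected graph and let $w$ be an even closed walk of $G$. Then $w$ is primitive if and only if the following three conditions hold: (1) every block of $\mathbf{w}$ is a cycle or a cut edge; (2) every multiple edge of the walk $w$ is a double edge of the walk $w$ and a cut edge of $\mathbf{w}$; (3) every cut vertex of $\mathbf{w}$ belongs to exactly two blocks of $\mathbf{w}$ and it is a sink of both.
   Context: A walk of $G$ is a finite sequence of edges $w=(\{v_{i_1},v_{i_2}\},\{v_{i_2},v_{i_3}\},\ldots,\{v_{i_q},v_{i_{q+1}}\})$, with each $e_{i_j}=\{v_{i_j},v_{i_{j+1}}\}\in E(G)$ and $q\ge 1$; its length is $q$, and it is even (odd) if $q$ is even (odd). It is closed if $v_{i_{q+1}}=v_{i_1}$. The same edge may appear several times in a walk; an edge appearing more than once in $w$ is called a multiple edge of $w$, and a double edge of $w$ if it appears exactly twice. The edges of $G$ are regarded as variables of a polynomial ring. A walk $w'=(e_{j_1},\ldots,e_{j_t})$ is a subwalk of $w=(e_{i_1},\ldots,e_{i_q})$ if the monomial $e_{j_1}\cdots e_{j_t}$ divides the monomial $e_{i_1}\cdots e_{i_q}$. For an even closed walk $w=(e_{i_1},\ldots,e_{i_{2q}})$ put $E^+(w)=\prod_{k=1}^{q}e_{i_{2k-1}}$ and $E^-(w)=\prod_{k=1}^{q}e_{i_{2k}}$. The even closed walk $w$ is called primitive if there is no even closed subwalk $\xi$ of $w$ of smaller length such that $E^+(\xi)\mid E^+(w)$ and $E^-(\xi)\mid E^-(w)$. $\mathbf{w}$ denotes the subgraph of $G$ whose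 vertices are the vertices of $w$ and whose edges are the edges of $w$. A cut edge (cut vertex) of a graph is an edge (vertex) whose removal increases the number of connected components. A graph is biconnected if it is connected and has no cut vertex; a block of a graph is a maximal biconnected subgraph. The edges of $w$ in odd positions $e_{i_1},e_{i_3},\ldots$ are called odd edges of $w$, those in even positions even edges of $w$. A sink of a block $B$ of $\mathbf{w}$ is a common vertex of two odd or of two even edges of the walk $w$ which belong to $B$; here edges of the walk are counted as occurrences, so that an edge appearing twice in $w$, both times as an odd edge or both times as an even edge, counts as two such edges and makes both of its endpoints sinks of its block. *)

theory Defs
  imports Main "HOL-Library.Multiset"
begin

type_synonym 'a ugraph = "'a set \<times> 'a set set"

abbreviation verts :: "'a ugraph \<Rightarrow> 'a set" where "verts \<equiv> fst"
abbreviation edges :: "'a ugraph \<Rightarrow> 'a set set" where "edges \<equiv> snd"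

definition simple_graph :: "'a ugraph \<Rightarrow> bool" where
  "simple_graph G \<longleftrightarrow> (\<forall>e\<in>edges G. e \<subseteq> verts G \<and> card e = 2)"

definition reachable :: "'a ugraph \<Rightarrow> ('a \<times> 'a) set" where
  "reachable G = {(u, v). u \<in> verts G \<and> v \<in> verts G \<and> (u, v) \<in> {(x, y). {x, y} \<in> edges G}\<^sup>*}"

definition connected_graph :: "'a ugraph \<Rightarrow> bool" where
  "connected_graph G \<longleftrightarrow> verts G \<noteq> {} \<and> (\<forall>u\<in>verts G. \<forall>v\<in>verts G. (u, v) \<in> reachable G)"

text \<open>The vertex sets of the connected components. They are counted with \<open>card\<close>, so the
  notions of cut edge and cut vertex below are meant for finite graphs.\<close>

definition components :: "'a ugraph \<Rightarrow> 'a set set" where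
  "components G = verts G // reachable G"

definition delete_edge :: "'a ugraph \<Rightarrow> 'a set \<Rightarrow> 'a ugraph" where
  "delete_edge G e = (verts G, edges G - {e})"

definition delete_vertex :: "'a ugraph \<Rightarrow> 'a \<Rightarrow> 'a ugraph" where
  "delete_vertex G v = (verts G - {v}, {e \<in> edges G. v \<notin> e})"

definition cut_edge :: "'a ugraph \<Rightarrow> 'a set \<Rightarrow> bool" where
  "cut_edge G e \<longleftrightarrow> e \<in> edges G \<and> card (components (delete_edge G e)) > card (components G)"

definition cut_vertex :: "'a ugraph \<Rightarrow> 'a \<Rightarrow> bool" where
  "cut_vertex G v \<longleftrightarrow> v \<in> verts G \<and> card (components (delete_vertex G v)) > card (components G)"

definition subgraph :: "'a ugraph \<Rightarrow> 'a ugraph \<Rightarrow> bool" where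
  "subgraph H G \<longleftrightarrow> simple_graph H \<and> verts H \<subseteq> verts G \<and> edges H \<subseteq> edges G"

definition biconnected :: "'a ugraph \<Rightarrow> bool" where
  "biconnected G \<longleftrightarrow> connected_graph G \<and> (\<nexists>v. cut_vertex G v)"

definition block :: "'a ugraph \<Rightarrow> 'a ugraph \<Rightarrow> bool" where
  "block G B \<longleftrightarrow> subgraph B G \<and> biconnected B \<and>
     (\<forall>B'. subgraph B' G \<and> biconnected B' \<and> subgraph B B' \<longrightarrow> B' = B)"

definition cycle_graph :: "'a ugraph \<Rightarrow> bool" where
  "cycle_graph G \<longleftrightarrow> (\<exists>vs. distinct vs \<and> length vs \<ge> 3 \<and> verts G = set vs \<and>
     edges G = {{vs ! i, vs ! (Suc i mod length vs)} |i. i < length vs})"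

definition edge_graph :: "'a set \<Rightarrow> 'a ugraph" where
  "edge_graph e = (e, {e})"

text \<open>A walk is its list of edges; \<open>traces vs w\<close> says that \<open>w\<close> runs through the vertices \<open>vs\<close>
  in this order.\<close>

definition traces :: "'a list \<Rightarrow> 'a set list \<Rightarrow> bool" where
  "traces vs w \<longleftrightarrow> length vs = Suc (length w) \<and> (\<forall>j<length w. w ! j = {vs ! j, vs ! Suc j})"

definition even_closed_walk :: "'a ugraph \<Rightarrow> 'a set list \<Rightarrow> bool" where
  "even_closed_walk G w \<longleftrightarrow> w \<noteq> [] \<and> set w \<subseteq> edges G \<and> even (length w) \<and>
     (\<exists>vs. traces vs w \<and> last vs = hd vs)"

definition walk_graph :: "'a set list \<Rightarrow> 'a ugraph" where
  "walk_graph w = (\<Union>(set w), set w)"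

text \<open>A monomial in the edge variables is represented by the multiset of its factors, so that
  divisibility of monomials is \<open>\<subseteq>#\<close>. List positions start at 0, hence the odd edges of a walk
  (its first, third, ... edge) sit at the even indices.\<close>

definition E_plus :: "'a set list \<Rightarrow> 'a set multiset" where
  "E_plus w = mset (nths w {k. even k})"

definition E_minus :: "'a set list \<Rightarrow> 'a set multiset" where
  "E_minus w = mset (nths w {k. odd k})"

definition subwalk :: "'a set list \<Rightarrow> 'a set list \<Rightarrow> bool" where
  "subwalk w' w \<longleftrightarrow> mset w' \<subseteq># mset w"

definition primitive :: "'a ugraph \<Rightarrow> 'a set list \<Rightarrow> bool" where
  "primitive G w \<longleftrightarrow> even_closed_walk G w \<and>
     \<not> (\<exists>\<xi>. even_closed_walk G \<xi> \<and> subwalk \<xi> w \<and> length \<xi> < length w \<and>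
            E_plus \<xi> \<subseteq># E_plus w \<and> E_minus \<xi> \<subseteq># E_minus w)"

definition multiple_edge :: "'a set list \<Rightarrow> 'a set \<Rightarrow> bool" where
  "multiple_edge w e \<longleftrightarrow> count (mset w) e > 1"

definition double_edge :: "'a set list \<Rightarrow> 'a set \<Rightarrow> bool" where
  "double_edge w e \<longleftrightarrow> count (mset w) e = 2"

text \<open>The positions \<open>i\<close> and \<open>j\<close> are distinct, but the edges there may coincide: an edge occurring
  twice with the same parity makes both its endpoints sinks.\<close>

definition sink :: "'a set list \<Rightarrow> 'a ugraph \<Rightarrow> 'a \<Rightarrow> bool" where
  "sink w B v \<longleftrightarrow> (\<exists>i j. i < length w \<and> j < length w \<and> i \<noteq> j \<and> (even i \<longleftrightarrow> even j) \<and>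
     w ! i \<in> edges B \<and> w ! j \<in> edges B \<and> v \<in> w ! i \<and> v \<in> w ! j)"

end

theory Submission
  imports Defs
begin

text \<open>Write the walk as a periodic sequence of vertices. If it is primitive, two visits of the same
  vertex have opposite parity, since otherwise the walk splits into two even closed walks. Reversing
  the arc between two visits of a vertex leaves \<open>E_plus\<close> and \<open>E_minus\<close> unchanged but flips the
  parity of the times inside the arc, so visits of two different vertices never interleave. Hence a
  vertex visited twice separates the two arcs between its visits, which yields the three conditions.

  Conversely, let \<open>\<xi>\<close> be an even closed subwalk. Within a block and at a vertex the walk \<open>w\<close> has
  exactly two edge occurrences, and \<open>\<xi>\<close> has an even number of them, because a closed walk crosses a
  cut an even number of times. So \<open>\<xi>\<close> uses both or neither, and as odd and even edges balance at
  every vertex, the sink condition forces the same choice for both blocks at a cut vertex. By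
  connectedness \<open>\<xi>\<close> is all of \<open>w\<close>.\<close>

section \<open>Cuts, paths and cycles\<close>

text \<open>The obstacle is that blocks are defined by maximality and cut vertices by counting
  components, while the walk gives only local information around each visit. The bridge is a local
  criterion: two edges at \<open>v\<close> lie in one block iff their other ends are linked after
  deleting \<open>v\<close>. It turns separated arcs directly into distinct blocks. In the converse
  it exhibits the edges of a block at \<open>v\<close> as the boundary of one component of the graph
  without \<open>v\<close>; this is the cut that a closed walk crosses evenly. Odd gaps also bound
  the number of visits: among three visits of a vertex within one period, the longest gap would be
  the sum of two odd gaps. Hence a vertex has at most two arcs, and so at most two blocks.
  Primitivity depends only on the length and on the unordered pair of \<open>E_plus\<close> and
  \<open>E_minus\<close>. This invariance is what permits moving the starting point of the walk and
  reversing arcs.\<close>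

definition adj :: "'a set set \<Rightarrow> ('a \<times> 'a) set" where
  "adj E = {(x, y). {x, y} \<in> E}"

lemma mem_adj_iff [simp]: "(x, y) \<in> adj E \<longleftrightarrow> {x, y} \<in> E"
  by (simp add: adj_def)

lemma reachable_iff:
  "(x, y) \<in> reachable G \<longleftrightarrow> x \<in> verts G \<and> y \<in> verts G \<and> (x, y) \<in> (adj (edges G))\<^sup>*"
  by (simp add: reachable_def adj_def)

lemma adj_rtrancl_sym:
  assumes "(x, y) \<in> (adj E)\<^sup>*"
  shows "(y, x) \<in> (adj E)\<^sup>*"
proof -
  have "sym (adj E)"
    by (auto simp: sym_def insert_commute)
  then show ?thesis
    using assms by (meson sym_rtrancl symD)
qed

lemma adj_rtrancl_mono:
  assumes "(x, y) \<in> (adj E)\<^sup>*" "E \<subseteq> F"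
  shows "(x, y) \<in> (adj F)\<^sup>*"
proof -
  have "adj E \<subseteq> adj F"
    using assms(2) by (auto simp: adj_def)
  then show ?thesis
    using assms(1) rtrancl_mono by blast
qed

text \<open>Unreachability is proved through this rule: a set that contains \<open>x\<close>, misses
  the target and is closed under edges serves as a certificate.\<close>

lemma adj_rtrancl_closed:
  assumes "(x, y) \<in> (adj E)\<^sup>*" "x \<in> S"
    and "\<And>a b. {a, b} \<in> E \<Longrightarrow> a \<in> S \<Longrightarrow> b \<in> S"
  shows "y \<in> S"
  using assms(1,2) by (induction rule: rtrancl_induct) (auto intro: assms(3))

lemma equiv_reachable: "equiv (verts G) (reachable G)"
proof (rule equivI)
  show "refl_on (verts G) (reachable G)" "reachable G \<subseteq> verts G \<times> verts G"
    by (auto simp: refl_on_def reachable_iff dest: reachable_iff[THEN iffD1])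
  show "sym (reachable G)"
    by (auto simp: sym_def reachable_iff intro: adj_rtrancl_sym)
  show "trans (reachable G)"
    by (auto simp: trans_def reachable_iff)
qed

text \<open>Translates the component counts in \<open>cut_edge\<close> and \<open>cut_vertex\<close>
  into an unlinked pair. Finiteness matters because \<open>card\<close> of an infinite quotient is
  0.\<close>

lemma card_quotient_gt_1_iff:
  assumes "equiv A r" "finite A"
  shows "1 < card (A // r) \<longleftrightarrow> (\<exists>x\<in>A. \<exists>y\<in>A. (x, y) \<notin> r)"
proof
  assume *: "1 < card (A // r)"
  show "\<exists>x\<in>A. \<exists>y\<in>A. (x, y) \<notin> r"
  proof (rule ccontr)
    assume "\<not> ?thesis"
    then have "A // r \<subseteq> {A}"
      using assms(1) by (auto simp: quotient_def equiv_def)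
    then have "card (A // r) \<le> 1"
      using card_mono[of "{A}"] by fastforce
    then show False
      using * by simp
  qed
next
  assume "\<exists>x\<in>A. \<exists>y\<in>A. (x, y) \<notin> r"
  then obtain x y where xy: "x \<in> A" "y \<in> A" "(x, y) \<notin> r"
    by blast
  then have "r `` {x} \<noteq> r `` {y}"
    using assms(1) by (metis eq_equiv_class)
  moreover have "{r `` {x}, r `` {y}} \<subseteq> A // r"
    using xy by (auto intro: quotientI)
  moreover have "finite (A // r)"
    using assms by (auto simp: equiv_def intro: finite_quotient)
  ultimately have "card {r `` {x}, r `` {y}} \<le> card (A // r)"
    by (intro card_mono)
  then show "1 < card (A // r)"
    using \<open>r `` {x} \<noteq> r `` {y}\<close> by simp
qed

lemma card_components_connected:
  assumes "connected_graph G"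
  shows "card (components G) = 1"
proof -
  have "components G = {verts G}"
    using assms equiv_reachable[of G]
    by (auto simp: components_def quotient_def connected_graph_def equiv_def)
  then show ?thesis
    by simp
qed

text \<open>A connected graph has exactly one component, so the count grows iff the deletion leaves
  two vertices unlinked.\<close>

lemma cut_vertex_iff:
  assumes "connected_graph G" "finite (verts G)"
  shows "cut_vertex G v \<longleftrightarrow> v \<in> verts G \<and>
    (\<exists>x y. x \<in> verts G - {v} \<and> y \<in> verts G - {v} \<and> (x, y) \<notin> (adj {e \<in> edges G. v \<notin> e})\<^sup>*)"
  using card_quotient_gt_1_iff[OF equiv_reachable[of "delete_vertex G v"]] assms
  by (auto simp: cut_vertex_def card_components_connected components_def[symmetric])
    (auto simp: reachable_iff delete_vertex_def)

lemma cut_edge_iff: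
  assumes "connected_graph G" "finite (verts G)"
  shows "cut_edge G e \<longleftrightarrow> e \<in> edges G \<and>
    (\<exists>x y. x \<in> verts G \<and> y \<in> verts G \<and> (x, y) \<notin> (adj (edges G - {e}))\<^sup>*)"
  using card_quotient_gt_1_iff[OF equiv_reachable[of "delete_edge G e"]] assms
  by (auto simp: cut_edge_def card_components_connected components_def[symmetric])
    (auto simp: reachable_iff delete_edge_def)

lemma connected_graph_iff:
  "connected_graph G \<longleftrightarrow> verts G \<noteq> {} \<and> (\<forall>x\<in>verts G. \<forall>y\<in>verts G. (x, y) \<in> (adj (edges G))\<^sup>*)"
  by (auto simp: connected_graph_def reachable_iff)

lemma biconnected_iff:
  assumes "simple_graph G" "finite (verts G)"
  shows "biconnected G \<longleftrightarrow> connected_graph G \<and>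
    (\<forall>v. \<forall>x\<in>verts G - {v}. \<forall>y\<in>verts G - {v}. (x, y) \<in> (adj {e \<in> edges G. v \<notin> e})\<^sup>*)"
proof (cases "connected_graph G")
  case True
  \<comment> \<open>Deleting a vertex outside \<open>G\<close> removes no edge, which lets
    \<open>v\<close> range over the whole type in the criterion.\<close>
  have "(x, y) \<in> (adj {e \<in> edges G. v \<notin> e})\<^sup>*" if "v \<notin> verts G" "x \<in> verts G" "y \<in> verts G" for v x y
  proof -
    have "{e \<in> edges G. v \<notin> e} = edges G"
      using that assms by (auto simp: simple_graph_def)
    then show ?thesis
      using True that by (simp add: connected_graph_iff)
  qed
  then show ?thesis
    using True assms by (simp add: biconnected_def cut_vertex_iff) blast
qed (simp add: biconnected_def)

lemma edge_obtain_other: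
  assumes "simple_graph G" "e \<in> edges G" "v \<in> e"
  obtains x where "e = {v, x}" "x \<noteq> v" "x \<in> verts G" "v \<in> verts G"
proof -
  have "card e = 2" "e \<subseteq> verts G"
    using assms by (auto simp: simple_graph_def)
  then obtain a b where "e = {a, b}" "a \<noteq> b"
    by (auto simp: card_2_iff)
  then show ?thesis
    using that assms \<open>e \<subseteq> verts G\<close> by (metis insert_iff insert_commute insert_subset singletonD)
qed

lemma connected_graph_incident_edge:
  assumes "connected_graph G" "simple_graph G" "v \<in> verts G" "u \<in> verts G" "u \<noteq> v"
  obtains x where "{v, x} \<in> edges G" "x \<noteq> v" "x \<in> verts G"
proof -
  have "(v, u) \<in> (adj (edges G))\<^sup>*"
    using assms by (simp add: connected_graph_iff)
  then obtain x where "{v, x} \<in> edges G"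
    using assms(5) by (auto elim: converse_rtranclE)
  moreover from this obtain y where "{v, x} = {v, y}" "y \<noteq> v" "y \<in> verts G"
    using assms(2) by (meson edge_obtain_other insertI1)
  ultimately show ?thesis
    using that by simp
qed

text \<open>Of two shared vertices at least one survives the deletion of any single vertex, and the
  two halves stay linked through it.\<close>

lemma biconnected_union:
  assumes "simple_graph A" "finite (verts A)" "biconnected A"
    and "simple_graph B" "finite (verts B)" "biconnected B"
    and "a \<in> verts A" "a \<in> verts B" "b \<in> verts A" "b \<in> verts B" "a \<noteq> b"
  shows "biconnected (verts A \<union> verts B, edges A \<union> edges B)" (is "biconnected ?U")
proof -
  have su: "simple_graph ?U" "finite (verts ?U)"
    using assms by (auto simp: simple_graph_def)
  have link: "(x, y) \<in> (adj F)\<^sup>*"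
    if "x \<in> X \<union> Y" "y \<in> X \<union> Y" "c \<in> X" "c \<in> Y"
      "\<forall>x\<in>X. \<forall>y\<in>X. (x, y) \<in> (adj F)\<^sup>*" "\<forall>x\<in>Y. \<forall>y\<in>Y. (x, y) \<in> (adj F)\<^sup>*" for x y c X Y F
  proof -
    have "(x, c) \<in> (adj F)\<^sup>*" "(c, y) \<in> (adj F)\<^sup>*"
      using that by blast+
    then show ?thesis
      by (rule rtrancl_trans)
  qed
  have A: "\<forall>x\<in>verts A. \<forall>y\<in>verts A. (x, y) \<in> (adj (edges A \<union> edges B))\<^sup>*"
    and B: "\<forall>x\<in>verts B. \<forall>y\<in>verts B. (x, y) \<in> (adj (edges A \<union> edges B))\<^sup>*"
    using assms
    by (auto simp: biconnected_def connected_graph_iff intro!: adj_rtrancl_mono[where F = "edges A \<union> edges B"])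
  have "connected_graph ?U"
    using assms link[OF _ _ _ _ A B] by (auto simp: connected_graph_iff)
  moreover have "(x, y) \<in> (adj {e \<in> edges ?U. v \<notin> e})\<^sup>*"
    if xy: "x \<in> verts ?U - {v}" "y \<in> verts ?U - {v}" for v x y
  proof -
    obtain c where "c \<in> verts A - {v}" "c \<in> verts B - {v}"
      using assms by (metis Diff_iff singletonD)
    moreover have "\<forall>x\<in>verts A - {v}. \<forall>y\<in>verts A - {v}. (x, y) \<in> (adj {e \<in> edges ?U. v \<notin> e})\<^sup>*"
    proof (intro ballI)
      fix x y assume "x \<in> verts A - {v}" "y \<in> verts A - {v}"
      then have "(x, y) \<in> (adj {e \<in> edges A. v \<notin> e})\<^sup>*"
        using assms(1-3) biconnected_iff by blast
      then show "(x, y) \<in> (adj {e \<in> edges ?U. v \<notin> e})\<^sup>*"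
        by (rule adj_rtrancl_mono) auto
    qed
    moreover have "\<forall>x\<in>verts B - {v}. \<forall>y\<in>verts B - {v}. (x, y) \<in> (adj {e \<in> edges ?U. v \<notin> e})\<^sup>*"
    proof (intro ballI)
      fix x y assume "x \<in> verts B - {v}" "y \<in> verts B - {v}"
      then have "(x, y) \<in> (adj {e \<in> edges B. v \<notin> e})\<^sup>*"
        using assms(4-6) biconnected_iff by blast
      then show "(x, y) \<in> (adj {e \<in> edges ?U. v \<notin> e})\<^sup>*"
        by (rule adj_rtrancl_mono) auto
    qed
    ultimately show ?thesis
      using xy by (intro link[of x "verts A - {v}" "verts B - {v}" y c]) auto
  qed
  ultimately show ?thesis
    using biconnected_iff[OF su] by blast
qed

section \<open>Paths and cycles as lists of vertices\<close>

fun path_edges :: "'a list \<Rightarrow> 'a set set" where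
  "path_edges (x # y # zs) = insert {x, y} (path_edges (y # zs))"
| "path_edges _ = {}"

lemma path_edges_append:
  "path_edges (xs @ y # zs) = path_edges (xs @ [y]) \<union> path_edges (y # zs)"
  by (induction xs rule: path_edges.induct) (auto split: list.splits)

lemma path_edges_conv_nth: "path_edges xs = {{xs ! i, xs ! Suc i} |i. Suc i < length xs}"
proof (induction xs rule: path_edges.induct)
  case (1 x y zs)
  have "{{(x # y # zs) ! i, (x # y # zs) ! Suc i} |i. Suc i < length (x # y # zs)} =
      insert {x, y} {{(y # zs) ! i, (y # zs) ! Suc i} |i. Suc i < length (y # zs)}"
    (is "?L = ?R")
  proof
    show "?L \<subseteq> ?R"
    proof
      fix e assume "e \<in> ?L"
      then obtain i where "e = {(x # y # zs) ! i, (x # y # zs) ! Suc i}" "Suc i < length (x # y # zs)"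
        by blast
      then show "e \<in> ?R"
        by (cases i) auto
    qed
    show "?R \<subseteq> ?L"
    proof
      fix e assume "e \<in> ?R"
      then consider "e = {x, y}" | i where "e = {(y # zs) ! i, (y # zs) ! Suc i}" "Suc i < length (y # zs)"
        by blast
      then show "e \<in> ?L"
      proof cases
        case 1
        then show ?thesis
          by (auto intro!: exI[of _ 0])
      next
        case (2 i)
        then show ?thesis
          by (auto intro!: exI[of _ "Suc i"])
      qed
    qed
  qed
  then show ?case
    using 1 by simp
qed auto

lemma path_edges_subset: "e \<in> path_edges xs \<Longrightarrow> e \<subseteq> set xs"
  by (induction xs rule: path_edges.induct) auto

lemma path_edges_connected:
  assumes "x \<in> set xs" "y \<in> set xs"
  shows "(x, y) \<in> (adj (path_edges xs))\<^sup>*"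
proof -
  have *: "z \<in> set (a # as) \<Longrightarrow> (a, z) \<in> (adj (path_edges (a # as)))\<^sup>*" for a z :: 'a and as
  proof (induction as arbitrary: a)
    case (Cons b as)
    show ?case
    proof (cases "z = a")
      case False
      then have "(b, z) \<in> (adj (path_edges (b # as)))\<^sup>*"
        using Cons by auto
      then have "(b, z) \<in> (adj (path_edges (a # b # as)))\<^sup>*"
        by (rule adj_rtrancl_mono) auto
      moreover have "(a, b) \<in> adj (path_edges (a # b # as))"
        by simp
      ultimately show ?thesis
        by (rule converse_rtrancl_into_rtrancl[rotated])
    qed simp
  qed simp
  obtain a as where "xs = a # as"
    using assms by (cases xs) auto
  then show ?thesis
    using *[of x a as] *[of y a as] assms adj_rtrancl_sym[of a x] by (meson rtrancl_trans)
qed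

text \<open>Induction on reachability: a new end vertex that already lies on the path truncates the
  path there, otherwise it extends it.\<close>

lemma distinct_path:
  assumes "(x, y) \<in> (adj E)\<^sup>*"
  shows "\<exists>q. distinct q \<and> q \<noteq> [] \<and> hd q = x \<and> last q = y \<and> path_edges q \<subseteq> E"
  using assms
proof (induction rule: rtrancl_induct)
  case base
  show ?case
    by (intro exI[of _ "[x]"]) simp
next
  case (step y z)
  then obtain q where q: "distinct q" "q \<noteq> []" "hd q = x" "last q = y" "path_edges q \<subseteq> E"
    by blast
  show ?case
  proof (cases "z \<in> set q")
    case True
    then obtain a b where "q = a @ z # b"
      by (meson split_list)
    then show ?thesis
      using q path_edges_append[of a z b] by (intro exI[of _ "a @ [z]"]) (auto simp: hd_append)
  next
    case False
    obtain r where "q = r @ [y]"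
      using q by (metis append_butlast_last_id)
    then show ?thesis
      using q False step path_edges_append[of r y "[z]"]
      by (intro exI[of _ "q @ [z]"]) (auto simp: hd_append)
  qed
qed

text \<open>The modular indices of \<open>cycle_graph\<close> are replaced by a path closed up with
  its own head, so that rotating and splitting a cycle become list operations.\<close>

definition cycle_on :: "'a list \<Rightarrow> 'a ugraph" where
  "cycle_on vs = (set vs, path_edges (vs @ [hd vs]))"

lemma cycle_graph_iff:
  "cycle_graph G \<longleftrightarrow> (\<exists>vs. distinct vs \<and> length vs \<ge> 3 \<and> G = cycle_on vs)"
proof -
  have "path_edges (vs @ [hd vs]) = {{vs ! i, vs ! (Suc i mod length vs)} |i. i < length vs}"
    if "length vs \<ge> 3" for vs :: "'a list"
  proof -
    have *: "(vs @ [hd vs]) ! i = vs ! i \<and> (vs @ [hd vs]) ! Suc i = vs ! (Suc i mod length vs)"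
      if "i < length vs" for i
    proof (cases "Suc i = length vs")
      case True
      then show ?thesis
        using that \<open>length vs \<ge> 3\<close> by (auto simp: nth_append hd_conv_nth[of vs] simp flip: length_greater_0_conv)
    next
      case False
      then show ?thesis
        using that by (auto simp: nth_append)
    qed
    then show ?thesis
      unfolding path_edges_conv_nth
      by (intro Collect_cong iff_exI rev_conj_cong) (simp_all add: * del: nth_append)
  qed
  then show ?thesis
    unfolding cycle_graph_def cycle_on_def by (auto simp: prod_eq_iff)
qed

lemma cycle_on_rotate: "cycle_on (a @ v # b) = cycle_on (v # b @ a)"
proof (cases a)
  case (Cons h a')
  show ?thesis
    using path_edges_append[of "h # a'" v "b @ [h]"] path_edges_append[of "v # b" h "a' @ [v]"] Cons
    by (auto simp: cycle_on_def)
qed (simp add: cycle_on_def)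

text \<open>Normal form of a cycle seen from \<open>v\<close>: its two neighbours \<open>x\<close>
  and \<open>y\<close> are the ends of the remaining path, and length at least 3 makes them
  distinct.\<close>

lemma cycle_on_obtain_at:
  assumes "distinct vs" "length vs \<ge> 3" "v \<in> set vs"
  obtains x q y where "distinct (v # x # q @ [y])" "cycle_on vs = cycle_on (v # x # q @ [y])"
proof -
  obtain a b where ab: "vs = a @ v # b"
    using assms by (meson split_list)
  have len: "length (b @ a) \<ge> 2"
    using assms ab by auto
  obtain x r where r: "b @ a = x # r"
    using len by (cases "b @ a") auto
  then have "r \<noteq> []"
    using len by auto
  then obtain q y where "r = q @ [y]"
    by (metis append_butlast_last_id)
  then have "b @ a = x # q @ [y]"
    using r by simp
  moreover have "distinct (v # b @ a)"
    using assms ab by auto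
  ultimately show ?thesis
    using that cycle_on_rotate[of a v b] ab by metis
qed

lemma edges_cycle_on:
  "edges (cycle_on (v # x # q @ [y])) = {{v, x}, {v, y}} \<union> path_edges (x # q @ [y])"
  using path_edges_append[of "v # x # q" y "[v]"] by (auto simp: cycle_on_def insert_commute)

lemma cycle_on_incident_edges:
  assumes "distinct vs" "length vs \<ge> 3" "v \<in> set vs"
  obtains x y where "x \<noteq> y" "{e \<in> edges (cycle_on vs). v \<in> e} = {{v, x}, {v, y}}"
proof -
  obtain x q y where c: "distinct (v # x # q @ [y])" "cycle_on vs = cycle_on (v # x # q @ [y])"
    using cycle_on_obtain_at[OF assms] .
  then have "{e \<in> edges (cycle_on vs). v \<in> e} = {{v, x}, {v, y}}"
    using path_edges_subset[of _ "x # q @ [y]"] by (auto simp: edges_cycle_on simp del: path_edges.simps)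
  then show ?thesis
    using that c by auto
qed

lemma simple_graph_cycle_on:
  assumes "distinct vs" "length vs \<ge> 3"
  shows "simple_graph (cycle_on vs)"
proof -
  have "card e = 2 \<and> e \<subseteq> set vs" if e: "e \<in> edges (cycle_on vs)" for e
  proof -
    have sub: "e \<subseteq> set (vs @ [hd vs])"
      using e path_edges_subset[of e "vs @ [hd vs]"] by (simp add: cycle_on_def)
    then have sub: "e \<subseteq> set vs"
      using assms by (cases vs) auto
    have "e \<noteq> {}"
      using e by (auto simp: cycle_on_def path_edges_conv_nth)
    then obtain v where "v \<in> e"
      by blast
    moreover obtain x q y where "distinct (v # x # q @ [y])" "cycle_on vs = cycle_on (v # x # q @ [y])"
      using cycle_on_obtain_at[OF assms] \<open>v \<in> e\<close> sub by blast
    ultimately show ?thesis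
      using e sub path_edges_subset[of e "x # q @ [y]"]
      by (auto simp: edges_cycle_on simp del: path_edges.simps)
  qed
  then show ?thesis
    by (simp add: simple_graph_def cycle_on_def)
qed

text \<open>In the normal form at a deleted vertex \<open>v\<close>, the path from \<open>x\<close>
  to \<open>y\<close> survives and contains all other vertices.\<close>

lemma biconnected_cycle_on:
  assumes "distinct vs" "length vs \<ge> 3"
  shows "biconnected (cycle_on vs)"
proof -
  have "connected_graph (cycle_on vs)"
    using assms path_edges_connected[of _ "vs @ [hd vs]"]
    by (auto simp: connected_graph_iff cycle_on_def)
  moreover have "(a, b) \<in> (adj {e \<in> edges (cycle_on vs). v \<notin> e})\<^sup>*"
    if ab: "a \<in> set vs - {v}" "b \<in> set vs - {v}" for v a b
  proof (cases "v \<in> set vs")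
    case True
    obtain x q y where c: "distinct (v # x # q @ [y])" "cycle_on vs = cycle_on (v # x # q @ [y])"
      using cycle_on_obtain_at[OF assms True] .
    have "set vs = set (v # x # q @ [y])"
      using c(2) by (simp add: cycle_on_def)
    then have "(a, b) \<in> (adj (path_edges (x # q @ [y])))\<^sup>*"
      using ab by (intro path_edges_connected) auto
    then show ?thesis
      using c path_edges_subset[of _ "x # q @ [y]"]
      by (elim adj_rtrancl_mono) (auto simp: edges_cycle_on simp del: path_edges.simps)
  next
    case False
    have "(a, b) \<in> (adj (path_edges vs))\<^sup>*"
      using ab by (intro path_edges_connected) auto
    moreover have "path_edges vs \<subseteq> edges (cycle_on vs)"
      by (auto simp: cycle_on_def path_edges_conv_nth nth_append)
    ultimately show ?thesis
      using False path_edges_subset[of _ vs] by (elim adj_rtrancl_mono) auto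
  qed
  ultimately show ?thesis
    using biconnected_iff[OF simple_graph_cycle_on[OF assms]] by (simp add: cycle_on_def)
qed

text \<open>The detour runs around the cycle the other way: \<open>b\<close> is one of the two
  neighbours of \<open>a\<close>, and the path between the neighbours avoids
  \<open>a\<close>.\<close>

lemma cycle_on_bypass_edge:
  assumes "distinct vs" "length vs \<ge> 3" "{a, b} \<in> edges (cycle_on vs)"
  shows "(a, b) \<in> (adj (edges (cycle_on vs) - {{a, b}}))\<^sup>*"
proof -
  have "a \<in> set vs"
    using simple_graph_cycle_on[OF assms(1,2)] assms(3) by (auto simp: simple_graph_def cycle_on_def)
  then obtain x q y where c: "distinct (a # x # q @ [y])" "cycle_on vs = cycle_on (a # x # q @ [y])"
    using cycle_on_obtain_at[OF assms(1,2)] by blast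
  have P: "(x, y) \<in> (adj (edges (cycle_on vs) - {{a, b}}))\<^sup>*"
  proof (rule adj_rtrancl_mono)
    show "(x, y) \<in> (adj (path_edges (x # q @ [y])))\<^sup>*"
      by (rule path_edges_connected) auto
    show "path_edges (x # q @ [y]) \<subseteq> edges (cycle_on vs) - {{a, b}}"
      using c path_edges_subset[of _ "x # q @ [y]"] by (auto simp: edges_cycle_on simp del: path_edges.simps)
  qed
  have "{a, b} = {a, x} \<or> {a, b} = {a, y}"
    using assms(3) c path_edges_subset[of "{a, b}" "x # q @ [y]"]
    by (auto simp: edges_cycle_on simp del: path_edges.simps)
  then consider "b = x" | "b = y"
    by (auto simp: doubleton_eq_iff)
  then show ?thesis
  proof cases
    case 1
    have "(a, y) \<in> adj (edges (cycle_on vs) - {{a, b}})"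
      using c 1 by (auto simp: edges_cycle_on doubleton_eq_iff)
    then show ?thesis
      using adj_rtrancl_sym[OF P] 1 by (meson converse_rtrancl_into_rtrancl)
  next
    case 2
    have "(a, x) \<in> adj (edges (cycle_on vs) - {{a, b}})"
      using c 2 by (auto simp: edges_cycle_on doubleton_eq_iff)
    then show ?thesis
      using P 2 by (meson converse_rtrancl_into_rtrancl)
  qed
qed

section \<open>Blocks\<close>

lemma subgraph_trans: "subgraph A B \<Longrightarrow> subgraph B C \<Longrightarrow> subgraph A C"
  by (auto simp: subgraph_def)

lemma subgraph_cycle_on:
  assumes "simple_graph G" "distinct vs" "length vs \<ge> 3" "edges (cycle_on vs) \<subseteq> edges G"
  shows "subgraph (cycle_on vs) G"
proof -
  have "v \<in> verts G" if v: "v \<in> set vs" for v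
  proof -
    obtain x y where "{e \<in> edges (cycle_on vs). v \<in> e} = {{v, x}, {v, y}}"
      using cycle_on_incident_edges[OF assms(2,3) v] by blast
    then have "{v, x} \<in> edges G"
      using assms(4) by blast
    then show ?thesis
      using assms(1) by (auto simp: simple_graph_def)
  qed
  then show ?thesis
    using assms simple_graph_cycle_on[OF assms(2,3)] by (auto simp: subgraph_def cycle_on_def)
qed

text \<open>A simple path from \<open>x\<close> to \<open>y\<close> that avoids \<open>v\<close>
  closes up to a cycle through \<open>v\<close>.\<close>

lemma cycle_through_adjacent_edges:
  assumes "{v, x} \<in> E" "{v, y} \<in> E" "x \<noteq> y" "(x, y) \<in> (adj {e \<in> E. v \<notin> e})\<^sup>*"
    and "v \<noteq> x"
  obtains vs where "distinct vs" "length vs \<ge> 3" "v \<in> set vs" "edges (cycle_on vs) \<subseteq> E"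
    "{v, x} \<in> edges (cycle_on vs)" "{v, y} \<in> edges (cycle_on vs)"
proof -
  obtain r where r: "distinct r" "r \<noteq> []" "hd r = x" "last r = y" "path_edges r \<subseteq> {e \<in> E. v \<notin> e}"
    using distinct_path[OF assms(4)] by blast
  then obtain r' where r': "r = x # r'"
    by (cases r) auto
  then have "r' \<noteq> []"
    using r assms by auto
  then obtain q where q: "r = x # q @ [y]"
    using r r' by (metis append_butlast_last_id last_ConsR)
  \<comment> \<open>A path is connected by its own edges; none of them contains \<open>v\<close> and
    it starts at \<open>x\<close>, which differs from \<open>v\<close>, so it cannot reach
    \<open>v\<close>.\<close>
  have "v \<notin> set r"
  proof
    assume "v \<in> set r"
    moreover have "path_edges r \<subseteq> {e. v \<notin> e}"
      using r by auto
    ultimately have "(x, v) \<in> (adj {e. v \<notin> e})\<^sup>*"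
      using q path_edges_connected[of x r v] by (auto elim: adj_rtrancl_mono)
    then show False
      using assms(5) by (auto elim: rtranclE)
  qed
  then have d: "distinct (v # x # q @ [y])"
    using r q by auto
  have e: "edges (cycle_on (v # x # q @ [y])) = {{v, x}, {v, y}} \<union> path_edges r"
    using q edges_cycle_on by metis
  show ?thesis
    by (rule that[of "v # x # q @ [y]"]) (use d e assms(1,2) r(5) in auto)
qed

lemma biconnected_edge_graph:
  assumes "a \<noteq> b"
  shows "biconnected (edge_graph {a, b})"
proof -
  have s: "simple_graph (edge_graph {a, b})" "finite (verts (edge_graph {a, b}))"
    using assms by (auto simp: simple_graph_def edge_graph_def)
  have "(a, b) \<in> (adj {{a, b}})\<^sup>*" "(b, a) \<in> (adj {{a, b}})\<^sup>*"
    by (auto simp: insert_commute)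
  then show ?thesis
    unfolding biconnected_iff[OF s] connected_graph_iff by (auto simp: edge_graph_def)
qed

text \<open>Collects the facts about blocks that need no walk visiting all edges; \<open>H\<close>
  is later the graph of the given walk.\<close>

locale finite_connected_graph =
  fixes H :: "'a ugraph"
  assumes simple: "simple_graph H" and finite_verts: "finite (verts H)"
    and connected: "connected_graph H"
begin

lemma finite_edges: "finite (edges H)"
proof (rule finite_subset)
  show "edges H \<subseteq> Pow (verts H)"
    using simple by (auto simp: simple_graph_def)
qed (use finite_verts in simp)

lemma edgeD: "{a, b} \<in> edges H \<Longrightarrow> a \<noteq> b \<and> a \<in> verts H \<and> b \<in> verts H"
  using simple by (force simp: simple_graph_def)

lemma finite_subgraph: "subgraph B H \<Longrightarrow> finite (verts B) \<and> finite (edges B)"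
  using finite_verts finite_edges by (auto simp: subgraph_def intro: finite_subset)

lemma subgraph_edge_graph: "e \<in> edges H \<Longrightarrow> subgraph (edge_graph e) H"
  using simple by (auto simp: subgraph_def simple_graph_def edge_graph_def)

text \<open>Among the finitely many biconnected subgraphs containing \<open>C\<close>, one that
  maximizes vertices plus edges is a block: under inclusion, equal sums force equal vertex sets and
  equal edge sets.\<close>

lemma biconnected_extends_to_block:
  assumes "subgraph C H" "biconnected C"
  obtains B where "block H B" "subgraph C B"
proof -
  define S where "S = {B. subgraph B H \<and> biconnected B \<and> subgraph C B}"
  define m where "m = (\<lambda>B :: 'a ugraph. card (verts B) + card (edges B))"
  have "S \<subseteq> Pow (verts H) \<times> Pow (edges H)"
    by (auto simp: S_def subgraph_def)
  then have "finite S"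
    using finite_verts finite_edges by (meson finite_Pow_iff finite_SigmaI finite_subset)
  have "C \<in> S"
    using assms by (auto simp: S_def subgraph_def)
  then have "Max (m ` S) \<in> m ` S"
    using \<open>finite S\<close> by (intro Max_in) auto
  then obtain B where B: "B \<in> S" "m B = Max (m ` S)"
    by auto
  have "B' = B" if "subgraph B' H" "biconnected B'" "subgraph B B'" for B'
  proof -
    have "B' \<in> S"
      using that B(1) by (auto simp: S_def intro: subgraph_trans)
    then have "m B' \<le> m B"
      using B(2) \<open>finite S\<close> by simp
    moreover have fin: "finite (verts B')" "finite (edges B')"
      using finite_subgraph that(1) by auto
    moreover have sub: "verts B \<subseteq> verts B'" "edges B \<subseteq> edges B'"
      using that(3) by (auto simp: subgraph_def)
    ultimately have "card (verts B') \<le> card (verts B)" "card (edges B') \<le> card (edges B)"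
      using card_mono[OF fin(1) sub(1)] card_mono[OF fin(2) sub(2)] by (auto simp: m_def)
    then have "verts B' = verts B" "edges B' = edges B"
      using card_seteq[OF fin(1) sub(1)] card_seteq[OF fin(2) sub(2)] by auto
    then show ?thesis
      by (simp add: prod_eq_iff)
  qed
  then show ?thesis
    using that[of B] B(1) by (auto simp: S_def block_def)
qed

lemma blockD:
  assumes "block H B"
  shows "subgraph B H" "biconnected B" "simple_graph B" "finite (verts B)" "connected_graph B"
    "verts B \<subseteq> verts H" "edges B \<subseteq> edges H"
  using assms finite_subgraph by (auto simp: block_def subgraph_def biconnected_def)

text \<open>\<open>biconnected_union\<close> makes the union of \<open>B\<close> and
  \<open>C\<close> biconnected, and maximality collapses it to \<open>B\<close>.\<close>

lemma block_absorbs: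
  assumes "block H B" "subgraph C H" "biconnected C"
    and "a \<in> verts B" "a \<in> verts C" "b \<in> verts B" "b \<in> verts C" "a \<noteq> b"
  shows "subgraph C B"
proof -
  let ?U = "(verts B \<union> verts C, edges B \<union> edges C)"
  have "biconnected ?U"
    using assms finite_subgraph blockD[OF assms(1)]
    by (intro biconnected_union) (auto simp: subgraph_def)
  moreover have "subgraph ?U H" "subgraph B ?U"
    using assms blockD(1)[OF assms(1)] by (auto simp: subgraph_def simple_graph_def)
  ultimately have "?U = B"
    using assms(1) unfolding block_def by blast
  moreover have "subgraph C ?U"
    using assms(2) by (auto simp: subgraph_def)
  ultimately show ?thesis
    by simp
qed

lemma block_unique:
  assumes "block H B" "block H C"
    and "a \<in> verts B" "a \<in> verts C" "b \<in> verts B" "b \<in> verts C" "a \<noteq> b"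
  shows "B = C"
  using block_absorbs[OF assms(1) blockD(1,2)[OF assms(2)] assms(3-7)] assms(1,2)
  unfolding block_def by blast

lemma block_edgeD:
  assumes "block H B" "{a, b} \<in> edges B"
  shows "a \<in> verts B" "b \<in> verts B" "a \<noteq> b"
  using blockD(3,7)[OF assms(1)] assms(2) edgeD by (auto simp: simple_graph_def)

lemma block_unique_edge:
  assumes "block H B" "block H C" "{a, b} \<in> edges B" "{a, b} \<in> edges C"
  shows "B = C"
  using block_unique[OF assms(1,2)] block_edgeD[OF assms(1,3)] block_edgeD[OF assms(2,4)] by blast

lemma edge_in_block:
  assumes "{a, b} \<in> edges H"
  obtains B where "block H B" "{a, b} \<in> edges B"
proof -
  obtain B where "block H B" "subgraph (edge_graph {a, b}) B"
    using biconnected_extends_to_block subgraph_edge_graph biconnected_edge_graph edgeD assms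
    by metis
  then show ?thesis
    using that by (auto simp: subgraph_def edge_graph_def)
qed

lemma block_edges_connected:
  assumes "block H B" "{v, x} \<in> edges B" "{v, y} \<in> edges B"
  shows "(x, y) \<in> (adj {e \<in> edges B. v \<notin> e})\<^sup>*"
  using assms blockD(2-4)[OF assms(1)] block_edgeD[OF assms(1)] biconnected_iff[of B] by blast

text \<open>The path from \<open>x\<close> to \<open>y\<close> around \<open>v\<close> closes to a
  cycle, which shares \<open>v\<close> and \<open>x\<close> with \<open>B\<close> and is therefore
  absorbed by it.\<close>

lemma block_cycle:
  assumes "block H B" "{v, x} \<in> edges B" "{v, y} \<in> edges H" "x \<noteq> y"
    and "(x, y) \<in> (adj {e \<in> edges H. v \<notin> e})\<^sup>*"
  obtains vs where "distinct vs" "length vs \<ge> 3" "v \<in> set vs" "subgraph (cycle_on vs) B"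
    "{v, x} \<in> edges (cycle_on vs)" "{v, y} \<in> edges (cycle_on vs)"
proof -
  have vx: "{v, x} \<in> edges H" "v \<in> verts B" "x \<in> verts B" "v \<noteq> x"
    using assms(2) blockD(7)[OF assms(1)] block_edgeD[OF assms(1,2)] by auto
  obtain vs where vs: "distinct vs" "length vs \<ge> 3" "v \<in> set vs" "edges (cycle_on vs) \<subseteq> edges H"
      "{v, x} \<in> edges (cycle_on vs)" "{v, y} \<in> edges (cycle_on vs)"
    using cycle_through_adjacent_edges[OF vx(1) assms(3-5) vx(4)] .
  have "v \<in> verts (cycle_on vs)" "x \<in> verts (cycle_on vs)"
    using simple_graph_cycle_on[OF vs(1,2)] vs(5) by (auto simp: simple_graph_def)
  then have "subgraph (cycle_on vs) B"
    using block_absorbs[OF assms(1) subgraph_cycle_on[OF simple vs(1,2,4)]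
        biconnected_cycle_on[OF vs(1,2)]] vx by blast
  then show ?thesis
    using that vs by blast
qed

text \<open>Together with \<open>block_edges_linked\<close> below: two edges at \<open>v\<close> lie in the same block iff their
  other ends are connected in \<open>H - v\<close>.\<close>

lemma block_contains_linked_edge:
  assumes "block H B" "{v, x} \<in> edges B" "{v, y} \<in> edges H"
    and "(x, y) \<in> (adj {e \<in> edges H. v \<notin> e})\<^sup>*"
  shows "{v, y} \<in> edges B"
proof (cases "x = y")
  case False
  obtain vs where "subgraph (cycle_on vs) B" "{v, y} \<in> edges (cycle_on vs)"
    using block_cycle[OF assms(1-3) False assms(4)] .
  then show ?thesis
    by (auto simp: subgraph_def)
qed (use assms in simp)

lemma block_edges_linked:
  assumes "block H B" "{v, x} \<in> edges B" "{v, y} \<in> edges B"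
  shows "(x, y) \<in> (adj {e \<in> edges H. v \<notin> e})\<^sup>*"
  using block_edges_connected[OF assms] blockD(7)[OF assms(1)] by (auto elim: adj_rtrancl_mono)

text \<open>The point is to exclude a block with a single vertex: as \<open>H\<close> is connected
  and has an edge, that vertex has a neighbour, and the \<open>edge_graph\<close> joining them would
  be a larger biconnected subgraph.\<close>

lemma block_incident_edge:
  assumes "block H B" "v \<in> verts B" "edges H \<noteq> {}"
  obtains x where "{v, x} \<in> edges B" "x \<noteq> v" "x \<in> verts B"
proof -
  have "\<exists>u\<in>verts B. u \<noteq> v"
  proof (rule ccontr)
    assume "\<not> ?thesis"
    then have B: "verts B = {v}"
      using assms(2) by blast
    obtain e where e: "e \<in> edges H"
      using assms(3) by blast
    then have "card e = 2" "e \<subseteq> verts H"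
      using simple by (auto simp: simple_graph_def)
    then obtain a b where "e = {a, b}" "a \<noteq> b"
      using card_2_iff[of e] by blast
    then obtain u where "u \<in> verts H" "u \<noteq> v"
      using \<open>e \<subseteq> verts H\<close> by blast
    then obtain x where x: "{v, x} \<in> edges H" "x \<noteq> v"
      using connected_graph_incident_edge[OF connected simple] assms(2) blockD(6)[OF assms(1)] by blast
    have "edges B = {}"
    proof (rule ccontr)
      assume "edges B \<noteq> {}"
      then obtain e where "e \<in> edges B"
        by blast
      then have "card e = 2" "e \<subseteq> {v}"
        using blockD(3)[OF assms(1)] B by (auto simp: simple_graph_def)
      moreover from \<open>e \<subseteq> {v}\<close> have "card e \<le> card {v}"
        by (intro card_mono) auto
      ultimately show False
        by simp
    qed
    then have "subgraph B (edge_graph {v, x})"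
      using B blockD(3)[OF assms(1)] by (auto simp: subgraph_def edge_graph_def)
    then have "edge_graph {v, x} = B"
      using assms(1) x subgraph_edge_graph biconnected_edge_graph[of v x] unfolding block_def by blast
    then show False
      using \<open>edges B = {}\<close> by (auto simp: edge_graph_def)
  qed
  then show ?thesis
    using that connected_graph_incident_edge[OF blockD(5,3)[OF assms(1)] assms(2)] by blast
qed

end

section \<open>Primitive walks are noncrossing\<close>

text \<open>Describing a walk by a function on times makes moving its start and reversing an arc
  mere changes of index.\<close>

definition walk_edges :: "(nat \<Rightarrow> 'a) \<Rightarrow> nat \<Rightarrow> 'a set list" where
  "walk_edges p n = map (\<lambda>k. {p k, p (Suc k)}) [0..<n]"

lemma length_walk_edges [simp]: "length (walk_edges p n) = n"
  by (simp add: walk_edges_def)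

lemma nth_walk_edges [simp]: "k < n \<Longrightarrow> walk_edges p n ! k = {p k, p (Suc k)}"
  by (simp add: walk_edges_def)

lemma walk_edges_add: "walk_edges p (m + n) = walk_edges p m @ walk_edges (\<lambda>k. p (k + m)) n"
  by (rule nth_equalityI) (auto simp: nth_append)

lemma traces_walk_edges: "traces vs w \<Longrightarrow> w = walk_edges (nth vs) (length w)"
  by (rule nth_equalityI) (auto simp: traces_def)

lemma even_closed_walkI:
  assumes "n > 0" "even n" "p n = p 0" "set (walk_edges p n) \<subseteq> edges G"
  shows "even_closed_walk G (walk_edges p n)"
proof -
  have "traces (map p [0..<Suc n]) (walk_edges p n)"
    by (auto simp: traces_def simp del: upt_Suc)
  moreover have "last (map p [0..<Suc n]) = hd (map p [0..<Suc n])"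
    using assms(3) by (simp add: last_map hd_map del: upt_Suc)
  ultimately show ?thesis
    using assms unfolding even_closed_walk_def by (auto simp flip: length_greater_0_conv simp del: upt_Suc)
qed

lemma even_closed_walkE:
  assumes "even_closed_walk G w"
  obtains p n where "w = walk_edges p n" "n > 0" "even n" "\<And>k. p (k + n) = p k"
    "set w \<subseteq> edges G"
proof -
  obtain vs where vs: "traces vs w" "last vs = hd vs" and w: "w \<noteq> []" "even (length w)" "set w \<subseteq> edges G"
    using assms by (auto simp: even_closed_walk_def)
  define n where "n = length w"
  \<comment> \<open>The last vertex of \<open>vs\<close> equals its first, so time \<open>n\<close>
    may wrap around to 0; the walk becomes periodic on all of \<open>nat\<close>.\<close>
  define p where "p = (\<lambda>k. vs ! (k mod n))"
  have len: "length vs = Suc n"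
    using vs(1) by (simp add: traces_def n_def)
  have "vs ! n = vs ! 0"
    using vs(2) len last_conv_nth[of vs] hd_conv_nth[of vs] by force
  then have "vs ! Suc k = p (Suc k)" if "k < n" for k
    using that by (cases "Suc k = n") (auto simp: p_def)
  moreover have "vs ! k = p k" if "k < n" for k
    using that by (simp add: p_def)
  ultimately have "walk_edges (nth vs) n = walk_edges p n"
    by (intro nth_equalityI) auto
  then have "w = walk_edges p n"
    using traces_walk_edges[OF vs(1)] by (simp add: n_def)
  then show ?thesis
    using that[of p n] w by (auto simp: n_def p_def)
qed

section \<open>Odd and even edges under concatenation and reversal\<close>

lemma E_plus_Cons [simp]: "E_plus (x # xs) = add_mset x (E_minus xs)"
  and E_minus_Cons [simp]: "E_minus (x # xs) = E_plus xs"
  by (auto simp: E_plus_def E_minus_def nths_Cons)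

lemma E_plus_Nil [simp]: "E_plus [] = {#}" and E_minus_Nil [simp]: "E_minus [] = {#}"
  by (auto simp: E_plus_def E_minus_def)

lemma E_plus_append:
  "E_plus (xs @ ys) = E_plus xs + (if even (length xs) then E_plus ys else E_minus ys)"
  and E_minus_append:
  "E_minus (xs @ ys) = E_minus xs + (if even (length xs) then E_minus ys else E_plus ys)"
  by (induction xs) auto

text \<open>Reversal sends position \<open>k\<close> to \<open>length xs - 1 - k\<close>, which
  keeps the parity exactly when the length is odd. Odd arcs can therefore be reversed in
  place.\<close>

lemma E_plus_rev: "E_plus (rev xs) = (if even (length xs) then E_minus xs else E_plus xs)"
  and E_minus_rev: "E_minus (rev xs) = (if even (length xs) then E_plus xs else E_minus xs)"
  by (induction xs) (auto simp: E_plus_append E_minus_append)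

lemma mset_E_plus_E_minus: "mset w = E_plus w + E_minus w"
  by (induction w) auto

lemma even_closed_walk_rev:
  assumes "even_closed_walk G w"
  shows "even_closed_walk G (rev w)"
proof -
  obtain vs where vs: "traces vs w" "last vs = hd vs"
    using assms by (auto simp: even_closed_walk_def)
  have "traces (rev vs) (rev w)"
    using vs(1) by (auto simp: traces_def rev_nth Suc_diff_Suc insert_commute)
  moreover have "last (rev vs) = hd (rev vs)"
    using vs(2) by (simp add: last_rev hd_rev)
  ultimately show ?thesis
    using assms by (auto simp: even_closed_walk_def)
qed

text \<open>If the two monomials are swapped, a witness \<open>\<xi>\<close> against
  \<open>w'\<close> becomes the witness \<open>rev \<xi>\<close> against \<open>w\<close>, since
  reversing an even walk swaps its monomials too.\<close>

lemma primitive_transfer: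
  assumes "primitive G w" "even_closed_walk G w'" "length w' = length w"
    and "E_plus w' = E_plus w \<and> E_minus w' = E_minus w \<or> E_plus w' = E_minus w \<and> E_minus w' = E_plus w"
  shows "primitive G w'"
  unfolding primitive_def
proof (intro conjI notI)
  assume "\<exists>\<xi>. even_closed_walk G \<xi> \<and> subwalk \<xi> w' \<and> length \<xi> < length w' \<and>
      E_plus \<xi> \<subseteq># E_plus w' \<and> E_minus \<xi> \<subseteq># E_minus w'"
  then obtain \<xi> where \<xi>: "even_closed_walk G \<xi>" "subwalk \<xi> w'" "length \<xi> < length w'"
      "E_plus \<xi> \<subseteq># E_plus w'" "E_minus \<xi> \<subseteq># E_minus w'"
    by blast
  have "mset w' = mset w"
    using assms(4) by (auto simp: mset_E_plus_E_minus)
  then have sub: "subwalk \<xi> w" "subwalk (rev \<xi>) w"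
    using \<xi>(2) by (auto simp: subwalk_def)
  have "even (length \<xi>)"
    using \<xi>(1) by (simp add: even_closed_walk_def)
  then show False
    using assms(1,3,4) \<xi> sub even_closed_walk_rev[OF \<xi>(1)]
    unfolding primitive_def by (metis E_plus_rev E_minus_rev length_rev)
qed (rule assms(2))

text \<open>Moving the start by one step swaps \<open>E_plus\<close> and \<open>E_minus\<close>,
  which \<open>primitive_transfer\<close> tolerates; induction gives any shift.\<close>

lemma primitive_shift:
  assumes "primitive G (walk_edges p n)" "\<And>k. p (k + n) = p k"
  shows "primitive G (walk_edges (\<lambda>k. p (k + i)) n)"
proof (induction i)
  case (Suc i)
  define q where "q = (\<lambda>k. p (k + i))"
  have q: "q n = q 0" "q (Suc n) = q (Suc 0)"
    using assms(2)[of i] assms(2)[of "Suc i"] by (simp_all add: q_def add_ac)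
  have ev: "even_closed_walk G (walk_edges q n)"
    using Suc by (simp add: primitive_def q_def)
  then have n: "n > 0" "even n" "set (walk_edges q n) \<subseteq> edges G"
    by (auto simp: even_closed_walk_def simp flip: length_greater_0_conv)
  then obtain m where m: "n = Suc m"
    by (cases n) auto
  \<comment> \<open>Both lists share their middle part of odd length \<open>m\<close>, so the edge
    moved from the front to the back changes parity, as do all the others.\<close>
  have c: "walk_edges q n = {q 0, q (Suc 0)} # walk_edges (\<lambda>k. q (Suc k)) m"
    using walk_edges_add[of q 1 m] m by (simp add: walk_edges_def)
  have s: "walk_edges (\<lambda>k. q (Suc k)) n = walk_edges (\<lambda>k. q (Suc k)) m @ [{q 0, q (Suc 0)}]"
    using walk_edges_add[of "\<lambda>k. q (Suc k)" m 1] m q by (simp add: walk_edges_def)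
  have E: "E_plus (walk_edges (\<lambda>k. q (Suc k)) n) = E_minus (walk_edges q n)"
      "E_minus (walk_edges (\<lambda>k. q (Suc k)) n) = E_plus (walk_edges q n)"
    unfolding c s using n(2) m by (simp_all add: E_plus_append E_minus_append)
  have "even_closed_walk G (walk_edges (\<lambda>k. q (Suc k)) n)"
    using n q c s by (intro even_closed_walkI) auto
  then have "primitive G (walk_edges (\<lambda>k. q (Suc k)) n)"
    using primitive_transfer[of G "walk_edges q n"] Suc E q_def by simp
  then show ?case
    by (simp add: q_def)
qed (use assms in simp)

text \<open>A prefix starts at position 0, so its edges keep their parity in \<open>w\<close>;
  closed and of even length, it would contradict primitivity directly.\<close>

lemma primitive_return_odd:
  assumes "primitive G (walk_edges p n)" "p j = p 0" "0 < j" "j < n"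
  shows "odd j"
proof
  assume "even j"
  let ?\<xi> = "walk_edges p j" and ?r = "walk_edges (\<lambda>k. p (k + j)) (n - j)"
  have w: "walk_edges p n = ?\<xi> @ ?r"
    using walk_edges_add[of p j "n - j"] assms(4) by simp
  have "set (walk_edges p n) \<subseteq> edges G"
    using assms(1) by (simp add: primitive_def even_closed_walk_def)
  then have "even_closed_walk G ?\<xi>"
    using assms \<open>even j\<close> w by (intro even_closed_walkI) auto
  moreover have "subwalk ?\<xi> (walk_edges p n)" "E_plus ?\<xi> \<subseteq># E_plus (walk_edges p n)"
      "E_minus ?\<xi> \<subseteq># E_minus (walk_edges p n)"
    unfolding w subwalk_def using \<open>even j\<close> by (auto simp: E_plus_append E_minus_append)
  ultimately show False
    using assms unfolding primitive_def by (metis length_walk_edges)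
qed

lemma primitive_visits_odd:
  assumes "primitive G (walk_edges p n)" "\<And>k. p (k + n) = p k"
    and "p i = p j" "i < j" "j < i + n"
  shows "odd (j - i)"
  using primitive_return_odd[OF primitive_shift[OF assms(1,2), of i], of "j - i"] assms(3-5) by simp

text \<open>Take \<open>i = 0\<close> after a shift. Reversing the arc up to \<open>j\<close> moves
  the visit at \<open>k\<close> to time \<open>j - k\<close>. Then \<open>l - k\<close> is odd in
  the old walk and \<open>l - (j - k)\<close> is odd in the new one. Their sum
  \<open>2 * l - j\<close> is even, although \<open>j\<close> is odd.\<close>

lemma primitive_noncrossing:
  assumes prim: "primitive G (walk_edges p n)" and per: "\<And>k. p (k + n) = p k"
    and "p i = p j" "p k = p l" "i < k" "k < j" "j < l" "l < i + n"
  shows False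
proof -
  have *: False if prim: "primitive G (walk_edges q n)" and per: "\<And>k. q (k + n) = q k"
    and jkl: "q 0 = q j" "q k = q l" "0 < k" "k < j" "j < l" "l < n" for q j k l
  proof -
    \<comment> \<open>\<open>r\<close> runs through the arc from \<open>0\<close> to \<open>j\<close> backwards.\<close>
    define r where "r = (\<lambda>t. if t mod n \<le> j then q (j - t mod n) else q (t mod n))"
    let ?a = "walk_edges q j" and ?b = "walk_edges (\<lambda>k. q (k + j)) (n - j)"
    have w: "walk_edges q n = ?a @ ?b"
      using walk_edges_add[of q j "n - j"] jkl by simp
    have r: "walk_edges r n = rev ?a @ ?b"
    proof (rule nth_equalityI)
      fix t assume "t < length (walk_edges r n)"
      then have t: "t < n"
        by simp
      show "walk_edges r n ! t = (rev ?a @ ?b) ! t"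
      proof (cases "t < j")
        case True
        then have "r t = q (j - t)" "r (Suc t) = q (j - Suc t)" "Suc (j - Suc t) = j - t"
          using jkl by (auto simp: r_def)
        then show ?thesis
          using True t by (simp add: nth_append rev_nth insert_commute)
      next
        case False
        have "q n = q 0"
          using per[of 0] by simp
        \<comment> \<open>The wrap needs care: for \<open>Suc t = n\<close> the definition of
          \<open>r\<close> gives \<open>q j\<close>, which is \<open>q 0\<close> and hence
          \<open>q n\<close>. At \<open>t = j\<close> it gives \<open>q 0\<close>, again equal to
          \<open>q j\<close>.\<close>
        then have "r t = q t" "r (Suc t) = q (Suc t)"
          using False t jkl by (cases "Suc t = n"; auto simp: r_def)+
        then show ?thesis
          using False t le_add_diff_inverse2[of j t] by (simp add: nth_append)
      qed
    qed (use jkl in simp)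
    have odd: "odd j"
      using primitive_return_odd[OF prim] jkl by auto
    have ev: "even_closed_walk G (walk_edges q n)"
      using prim by (simp add: primitive_def)
    have "even_closed_walk G (walk_edges r n)"
      using ev r w jkl by (intro even_closed_walkI) (auto simp: even_closed_walk_def r_def)
    then have "primitive G (walk_edges r n)"
      using primitive_transfer[OF prim] odd
      by (auto simp: r w E_plus_append E_minus_append E_plus_rev E_minus_rev)
    moreover have "r (j - k) = r l"
      using jkl by (simp add: r_def)
    moreover have "r (t + n) = r t" for t
      by (simp add: r_def)
    ultimately have "odd (l - (j - k))"
      using primitive_visits_odd[of G r n "j - k" l] jkl by simp
    moreover have "odd (l - k)"
      using primitive_visits_odd[OF prim per jkl(2)] jkl by simp
    ultimately show False
      using odd jkl by presburger
  qed
  have per': "p (t + n + i) = p (t + i)" for t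
    using per[of "t + i"] by (simp add: add_ac)
  show False
    by (rule *[of "\<lambda>t. p (t + i)" "j - i" "k - i" "l - i"])
      (use assms per' primitive_shift[OF prim per, of i] in auto)
qed

section \<open>Blocks of a noncrossing walk\<close>

text \<open>Of the ambient graph only the absence of loops is kept; the analysis takes place in the
  graph of the walk itself.\<close>

locale closed_walk =
  fixes p :: "nat \<Rightarrow> 'a" and n :: nat
  assumes pos: "n > 0" and periodic: "p (k + n) = p k"
    and no_loop_lt: "k < n \<Longrightarrow> p k \<noteq> p (Suc k)"
begin

definition step :: "nat \<Rightarrow> 'a set" where
  "step k = {p k, p (Suc k)}"

definition H :: "'a ugraph" where
  "H = walk_graph (walk_edges p n)"

lemma mod_eq: "p (k mod n) = p k"
proof -
  have "p (k + m * n) = p k" for k m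
  proof (induction m)
    case (Suc m)
    then show ?case
      using periodic[of "k + m * n"] by (simp add: add_ac)
  qed simp
  from this[of "k mod n" "k div n"] show ?thesis
    by simp
qed

lemma step_mod: "step (k mod n) = step k"
  unfolding step_def by (metis mod_eq mod_Suc_eq)

lemma no_loop: "p k \<noteq> p (Suc k)"
proof -
  have "p (Suc (k mod n)) = p (Suc k)"
    by (metis mod_eq mod_Suc_eq)
  then show ?thesis
    using no_loop_lt[of "k mod n"] pos by (simp add: mod_eq)
qed

text \<open>Every argument below may choose its period to start at a visit \<open>i\<close>, so that
  the cyclic order of times becomes the usual order on an interval.\<close>

lemma window: obtains l where "i \<le> l" "l < i + n" "l mod n = k mod n"
proof -
  \<comment> \<open>Modulo \<open>n\<close>, the term \<open>i * (n - 1)\<close> stands for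
    \<open>- i\<close>, which \<open>nat\<close> does not have.\<close>
  define l where "l = i + (k + i * (n - 1)) mod n"
  have "l mod n = (i + (k + i * (n - 1))) mod n"
    by (simp add: l_def mod_add_right_eq)
  also have "i + (k + i * (n - 1)) = k + i * n"
    using pos by (cases n) (auto simp: algebra_simps)
  finally show ?thesis
    using that[of l] pos by (auto simp: l_def)
qed

lemma window_vertex:
  assumes "v \<in> range p"
  obtains k where "i \<le> k" "k < i + n" "v = p k"
  using assms window[of i] mod_eq by (metis imageE)

lemma window_step:
  assumes "e \<in> range step"
  obtains k where "i \<le> k" "k < i + n" "e = step k"
  using assms window[of i] step_mod by (metis imageE)

lemma nth_step: "k < n \<Longrightarrow> walk_edges p n ! k = step k"
  by (simp add: step_def)

lemma verts_H: "verts H = range p" and edges_H: "edges H = range step"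
proof -
  have s: "set (walk_edges p n) = step ` {..<n}"
    by (auto simp: walk_edges_def step_def)
  also have "\<dots> = range step"
  proof
    show "range step \<subseteq> step ` {..<n}"
      using step_mod pos by (metis image_subsetI image_eqI lessThan_iff mod_less_divisor)
  qed auto
  finally show e: "edges H = range step"
    by (simp add: H_def walk_graph_def)
  have "verts H = \<Union> (range step)"
    using e by (simp add: H_def walk_graph_def)
  then show "verts H = range p"
    by (auto simp: step_def)
qed

lemma arc_connected:
  assumes "s \<le> t" "\<And>k. s \<le> k \<Longrightarrow> k \<le> t \<Longrightarrow> p k \<noteq> v"
  shows "(p s, p t) \<in> (adj {e \<in> edges H. v \<notin> e})\<^sup>*"
  using assms
proof (induction t rule: dec_induct)
  case (step t)
  have "v \<notin> step t"
    using step.prems[of t] step.prems[of "Suc t"] step.hyps by (auto simp: step_def)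
  then have "(p t, p (Suc t)) \<in> adj {e \<in> edges H. v \<notin> e}"
    by (auto simp: edges_H step_def)
  then show ?case
    using step by (meson le_Suc_eq rtrancl.rtrancl_into_rtrancl)
qed simp

sublocale finite_connected_graph H
proof
  show "simple_graph H"
    using no_loop by (auto simp: simple_graph_def verts_H edges_H step_def)
  have "range p = p ` {..<n}"
    using mod_eq pos by (auto simp: image_iff) (metis lessThan_iff mod_less_divisor)
  then show "finite (verts H)"
    by (simp add: verts_H)
  have *: "(p 0, p t) \<in> (adj (edges H))\<^sup>*" for t
  proof (induction t)
    case (Suc t)
    have "(p t, p (Suc t)) \<in> adj (edges H)"
      by (auto simp: edges_H step_def)
    then show ?case
      using Suc by (meson rtrancl.rtrancl_into_rtrancl)
  qed simp
  have "(p s, p t) \<in> (adj (edges H))\<^sup>*" for s t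
    by (rule rtrancl_trans[OF adj_rtrancl_sym[OF *] *])
  then show "connected_graph H"
    by (auto simp: connected_graph_iff verts_H)
qed

lemma edges_nonempty: "edges H \<noteq> {}"
  by (simp add: edges_H)

lemma count_walk_edges: "count (mset (walk_edges p n)) e = card {k. k < n \<and> step k = e}"
  by (simp add: count_mset count_list_eq_length_filter length_filter_conv_card step_def eq_commute cong: conj_cong)

end

text \<open>Isolates what the forward direction takes from primitivity: parity of gaps and absence
  of interleaving. The monomials no longer occur.\<close>

locale noncrossing_walk = closed_walk +
  assumes even: "even n"
    and visits_odd: "\<lbrakk>p i = p j; i < j; j < i + n\<rbrakk> \<Longrightarrow> odd (j - i)"
    and noncrossing: "\<lbrakk>p i = p j; p k = p l; i < k; k < j; j < l; l < i + n\<rbrakk> \<Longrightarrow> False"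
begin

text \<open>Between the arcs, equality would be interleaving. A third visit of \<open>p i\<close>
  would give three odd gaps, one of which is the sum of the other two.\<close>

lemma arcs_disjoint:
  assumes "p i = p j" "i < s" "s < j" "j < t" "t < i + n"
  shows "p s \<noteq> p t" "p s \<noteq> p i" "p t \<noteq> p i"
proof -
  show "p s \<noteq> p t"
    using noncrossing[of i j s t] assms by auto
  have "odd (j - i)"
    using visits_odd[of i j] assms by simp
  show "p s \<noteq> p i"
  proof
    assume "p s = p i"
    then have "odd (s - i)" "odd (j - s)"
      using visits_odd[of i s] visits_odd[of s j] assms by simp_all
    then show False
      using \<open>odd (j - i)\<close> assms(2,3) by presburger
  qed
  show "p t \<noteq> p i"
  proof
    assume "p t = p i"
    then have "odd (t - i)" "odd (t - j)"
      using visits_odd[of i t] visits_odd[of j t] assms by simp_all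
    then show False
      using \<open>odd (j - i)\<close> assms(2-4) by presburger
  qed
qed

text \<open>The vertices of the open arc from \<open>i\<close> to \<open>j\<close> are closed under
  the edges avoiding \<open>p i\<close>, because such an edge runs strictly inside one of the two
  arcs and the arcs are disjoint.\<close>

lemma arcs_separated:
  assumes "p i = p j" "i < s" "s < j" "j < t" "t < i + n"
  shows "(p s, p t) \<notin> (adj {e \<in> edges H. p i \<notin> e})\<^sup>*"
proof
  assume "(p s, p t) \<in> (adj {e \<in> edges H. p i \<notin> e})\<^sup>*"
  then have "p t \<in> p ` {i<..<j}"
  proof (rule adj_rtrancl_closed)
    fix a b assume ab: "{a, b} \<in> {e \<in> edges H. p i \<notin> e}" "a \<in> p ` {i<..<j}"
    then obtain s' where s': "a = p s'" "i < s'" "s' < j"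
      by auto
    obtain k where k: "i \<le> k" "k < i + n" "{a, b} = step k"
      by (rule window_step[of "{a, b}" i]) (use ab(1) in \<open>simp_all add: edges_H\<close>)
    have "p i \<notin> step k"
      using ab(1) k(3) by simp
    \<comment> \<open>Steps \<open>i\<close>, \<open>j - 1\<close>, \<open>j\<close> and
      \<open>i + n - 1\<close> touch \<open>p i\<close>; every other step of the period stays inside
      one arc.\<close>
    then have "k \<noteq> i" "k \<noteq> j" "Suc k \<noteq> j" "Suc k \<noteq> i + n"
      using assms(1) periodic[of i] by (auto simp: step_def)
    then consider "i < k" "Suc k < j" | "j < k" "Suc k < i + n"
      using k by linarith
    then show "b \<in> p ` {i<..<j}"
    proof cases
      case 1
      then have "step k \<subseteq> p ` {i<..<j}"
        by (auto simp: step_def)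
      then show ?thesis
        using k(3) by blast
    next
      case 2
      have "a = p k \<or> a = p (Suc k)"
        using k(3) by (auto simp: step_def doubleton_eq_iff)
      then show ?thesis
        using arcs_disjoint(1)[OF assms(1) s'(2,3), of k]
          arcs_disjoint(1)[OF assms(1) s'(2,3), of "Suc k"] 2 s'(1) by auto
    qed
  qed (use assms in auto)
  then obtain s' where "p t = p s'" "i < s'" "s' < j"
    by auto
  then show False
    using arcs_disjoint(1)[OF assms(1) _ _ assms(4,5), of s'] by simp
qed

text \<open>The arc itself links the inner ends of its first and last step without meeting
  \<open>p i\<close>, so the local criterion applies in both directions.\<close>

lemma arc_same_block:
  assumes "p i = p j" "i < j" "\<And>k. i < k \<Longrightarrow> k < j \<Longrightarrow> p k \<noteq> p i" "block H B"
  shows "step i \<in> edges B \<longleftrightarrow> step (j - 1) \<in> edges B"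
proof -
  have "j \<noteq> Suc i"
    using no_loop[of i] assms(1) by auto
  then have arc: "(p (Suc i), p (j - 1)) \<in> (adj {e \<in> edges H. p i \<notin> e})\<^sup>*"
    using assms by (intro arc_connected) auto
  have ends: "step i = {p i, p (Suc i)}" "step (j - 1) = {p i, p (j - 1)}"
    using assms(1,2) by (auto simp: step_def insert_commute)
  have "step i \<in> edges H" "step (j - 1) \<in> edges H"
    by (auto simp: edges_H)
  then show ?thesis
    unfolding ends
    using block_contains_linked_edge[OF assms(4) _ _ arc]
      block_contains_linked_edge[OF assms(4) _ _ adj_rtrancl_sym[OF arc]] by blast
qed

text \<open>Edges of one block at \<open>p i\<close> have linked outer ends, whereas
  \<open>arcs_separated\<close> keeps the two arcs apart.\<close>

lemma arcs_different_blocks: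
  assumes "p i = p j" "i < j" "j < i + n" "block H B" "step i \<in> edges B"
  shows "step j \<notin> edges B"
proof
  assume "step j \<in> edges B"
  then have "{p i, p (Suc i)} \<in> edges B" "{p i, p (Suc j)} \<in> edges B"
    using assms by (auto simp: step_def)
  then have "(p (Suc i), p (Suc j)) \<in> (adj {e \<in> edges H. p i \<notin> e})\<^sup>*"
    by (rule block_edges_linked[OF assms(4)])
  moreover have "Suc i < j" "Suc j < i + n"
    using assms(1-3) no_loop[of i] no_loop[of j] periodic[of i] by (metis Suc_lessI)+
  ultimately show False
    using arcs_separated[OF assms(1)] by auto
qed

lemma single_visit_between:
  assumes "p i = p j" "i < j" "j < i + n" "i < k" "k < j"
  shows "p k \<noteq> p i"
proof
  assume "p k = p i"
  then have "odd (k - i)" "odd (j - k)" "odd (j - i)"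
    using visits_odd[of i k] visits_odd[of k j] visits_odd[of i j] assms by simp_all
  then show False
    using assms(4,5) by presburger
qed

text \<open>Each visit contributes the step leaving it and the step entering it. The step entering
  visit \<open>i\<close> is written one period later, as \<open>i + n - 1\<close>, to stay inside
  the window.\<close>

lemma incident_step_twice:
  assumes "p i = p j" "i < j" "j < i + n" "e \<in> edges H" "p i \<in> e"
  shows "e \<in> {step i, step (j - 1), step j, step (i + n - 1)}"
proof -
  obtain k where k: "i \<le> k" "k < i + n" "e = step k"
    by (rule window_step[of e i]) (use assms(4) in \<open>simp_all add: edges_H\<close>)
  have visit: "l = i \<or> l = j \<or> l = i + n" if "i \<le> l" "l \<le> i + n" "p l = p i" for l
    using single_visit_between[OF assms(1-3), of l]
      single_visit_between[of j "i + n" l] assms that periodic[of i] by force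
  from k(3) assms(5) have "p k = p i \<or> p (Suc k) = p i"
    by (auto simp: step_def)
  then have "k = i \<or> k = j - 1 \<or> k = j \<or> k = i + n - 1"
    using visit[of k] visit[of "Suc k"] k(1,2) assms(2,3) by auto
  then show ?thesis
    by (elim disjE) (simp_all add: k(3))
qed

lemma incident_step_once:
  assumes "\<And>j. i < j \<Longrightarrow> j < i + n \<Longrightarrow> p j \<noteq> p i" "e \<in> edges H" "p i \<in> e"
  shows "e \<in> {step i, step (i + n - 1)}"
proof -
  obtain k where k: "i \<le> k" "k < i + n" "e = step k"
    by (rule window_step[of e i]) (use assms(2) in \<open>simp_all add: edges_H\<close>)
  have visit: "l = i \<or> l = i + n" if "i \<le> l" "l \<le> i + n" "p l = p i" for l
    using assms(1)[of l] that by linarith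
  from k(3) assms(3) have "p k = p i \<or> p (Suc k) = p i"
    by (auto simp: step_def)
  then have "k = i \<or> k = i + n - 1"
    using visit[of k] visit[of "Suc k"] k(1,2) by auto
  then show ?thesis
    by (elim disjE) (simp_all add: k(3))
qed

text \<open>The four steps at \<open>p i\<close> fall into two pairs, one for each arc; a block
  contains a pair as a whole, and \<open>B\<close> cannot contain both. The two steps of a pair may
  be the same edge.\<close>

lemma block_incident_twice:
  assumes "p i = p j" "i < j" "j < i + n" "block H B" "step i \<in> edges B"
  shows "{e \<in> edges B. p i \<in> e} = {step i, step (j - 1)}"
proof
  have "step (j - 1) \<in> edges B"
    using arc_same_block[OF assms(1,2) single_visit_between[OF assms(1-3)] assms(4)] assms(5)
    by blast
  moreover have "p i \<in> step (j - 1)"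
    using assms(1,2) by (simp add: step_def)
  ultimately show "{step i, step (j - 1)} \<subseteq> {e \<in> edges B. p i \<in> e}"
    using assms(5) by (auto simp: step_def)
  have j: "step j \<notin> edges B"
    by (rule arcs_different_blocks[OF assms])
  moreover have "step j \<in> edges B \<longleftrightarrow> step (i + n - 1) \<in> edges B"
  proof (rule arc_same_block[OF _ _ _ assms(4)])
    show "p j = p (i + n)"
      using assms(1) periodic by simp
    show "p k \<noteq> p j" if "j < k" "k < i + n" for k
      using single_visit_between[of j "i + n" k] assms that periodic[of i] by simp
  qed (use assms in simp)
  moreover have "edges B \<subseteq> edges H"
    using blockD assms(4) by blast
  ultimately show "{e \<in> edges B. p i \<in> e} \<subseteq> {step i, step (j - 1)}"
    using incident_step_twice[OF assms(1-3)] by blast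
qed

text \<open>If \<open>v\<close> were visited once per period, the rest of the period would be one
  arc that links all other vertices without \<open>v\<close>.\<close>

lemma cut_vertex_twice:
  assumes "cut_vertex H v"
  obtains i j where "v = p i" "p i = p j" "i < j" "j < i + n"
proof -
  obtain x y where xy: "x \<in> verts H - {v}" "y \<in> verts H - {v}"
      "(x, y) \<notin> (adj {e \<in> edges H. v \<notin> e})\<^sup>*" and "v \<in> verts H"
    using assms cut_vertex_iff[OF connected finite_verts] by blast
  from \<open>v \<in> verts H\<close> obtain i where i: "v = p i"
    by (auto simp: verts_H)
  obtain s where s: "i \<le> s" "s < i + n" "x = p s"
    by (rule window_vertex[of x i]) (use xy(1) in \<open>simp_all add: verts_H\<close>)
  obtain t where t: "i \<le> t" "t < i + n" "y = p t"
    by (rule window_vertex[of y i]) (use xy(2) in \<open>simp_all add: verts_H\<close>)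
  have "\<exists>j. i < j \<and> j < i + n \<and> p j = p i"
  proof (rule ccontr)
    assume *: "\<not> ?thesis"
    have "s \<noteq> i" "t \<noteq> i"
      using xy s t i by auto
    then have "p k \<noteq> v" if "min s t \<le> k" "k \<le> max s t" for k
    proof -
      have "i < k" "k < i + n"
        using s t that \<open>s \<noteq> i\<close> \<open>t \<noteq> i\<close> by auto
      then show ?thesis
        using * i by blast
    qed
    then have "(p (min s t), p (max s t)) \<in> (adj {e \<in> edges H. v \<notin> e})\<^sup>*"
      by (intro arc_connected) auto
    then have "(x, y) \<in> (adj {e \<in> edges H. v \<notin> e})\<^sup>*"
      using adj_rtrancl_sym s(3) t(3) by (cases "s \<le> t") (auto simp: min_def max_def)
    then show False
      using xy(3) by blast
  qed
  then show ?thesis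
    using that i by metis
qed

text \<open>Reducing to positions below \<open>n\<close> preserves parity because \<open>n\<close>
  is even, and distinctness because the two times are less than one period apart.\<close>

lemma sink_stepI:
  assumes "k < l" "l < k + n" "even (l - k)" "step k \<in> edges B" "step l \<in> edges B"
    and "v \<in> step k" "v \<in> step l"
  shows "sink (walk_edges p n) B v"
proof -
  have "k mod n \<noteq> l mod n"
  proof
    assume "k mod n = l mod n"
    then have "n dvd l - k"
      using assms(1) by (metis mod_eq_dvd_iff_nat less_imp_le)
    then show False
      using assms(1,2) by (auto dest: dvd_imp_le)
  qed
  moreover have "even (k mod n) \<longleftrightarrow> even k" "even (l mod n) \<longleftrightarrow> even l"
    using even by (simp_all add: dvd_mod_iff)
  ultimately show ?thesis
    unfolding sink_def
    using assms pos step_mod nth_step by (intro exI[of _ "k mod n"] exI[of _ "l mod n"]) auto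
qed

text \<open>As \<open>j - i\<close> is odd, the step leaving at \<open>i\<close> and the step
  entering at \<open>j\<close> have positions of equal parity. These are distinct positions even if
  both steps are the same edge.\<close>

lemma sink_twice:
  assumes "p i = p j" "i < j" "j < i + n" "block H B" "step i \<in> edges B"
  shows "sink (walk_edges p n) B (p i)"
proof (rule sink_stepI)
  have "step i \<in> {e \<in> edges B. p i \<in> e}" "step (j - 1) \<in> {e \<in> edges B. p i \<in> e}"
    using block_incident_twice[OF assms] by simp_all
  then show "step i \<in> edges B" "step (j - 1) \<in> edges B" "p i \<in> step i" "p i \<in> step (j - 1)"
    by auto
  have odd: "odd (j - i)"
    using visits_odd assms by simp
  moreover have "j \<noteq> Suc i"
    using no_loop[of i] assms(1) by auto
  ultimately show "i < j - 1" "even (j - 1 - i)"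
    using assms(2) by presburger+
qed (use assms in simp)

lemma blocks_twice:
  assumes "p i = p j" "i < j" "j < i + n"
  shows "card {B. block H B \<and> p i \<in> verts B} = 2"
    and "block H B \<Longrightarrow> p i \<in> verts B \<Longrightarrow> step i \<in> edges B \<or> step j \<in> edges B"
proof -
  \<comment> \<open>The two arcs exchange roles when \<open>(i, j)\<close> is replaced by
    \<open>(j, i + n)\<close>.\<close>
  have sym: "p j = p (i + n)" "j < i + n" "i + n < j + n"
    using assms periodic by simp_all
  show *: "step i \<in> edges B \<or> step j \<in> edges B" if B: "block H B" "p i \<in> verts B" for B
  proof -
    obtain x where x: "{p i, x} \<in> edges B"
      by (rule block_incident_edge[OF B edges_nonempty])
    then have "{p i, x} \<in> {step i, step (j - 1), step j, step (i + n - 1)}"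
      using incident_step_twice[OF assms] blockD(7)[OF that(1)] by blast
    moreover have "step i \<in> edges B \<longleftrightarrow> step (j - 1) \<in> edges B"
      using arc_same_block[OF assms(1,2) single_visit_between[OF assms(1-3)] that(1)] by blast
    moreover have "step j \<in> edges B \<longleftrightarrow> step (i + n - 1) \<in> edges B"
      using arc_same_block[OF sym(1,2) single_visit_between[OF sym] that(1)] by blast
    ultimately show ?thesis
      using x by auto
  qed
  obtain B1 where B1: "block H B1" "step i \<in> edges B1"
    using edge_in_block[of "p i" "p (Suc i)"] by (auto simp: edges_H step_def)
  obtain B2 where B2: "block H B2" "step j \<in> edges B2"
    using edge_in_block[of "p j" "p (Suc j)"] by (auto simp: edges_H step_def)
  have "B1 \<noteq> B2"
    using arcs_different_blocks[OF assms B1] B2 by auto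
  moreover have "{B. block H B \<and> p i \<in> verts B} = {B1, B2}"
  proof -
    have "p i \<in> verts B1" "p i \<in> verts B2"
      using B1 B2 block_edgeD assms(1) by (auto simp: step_def)
    moreover have "B = B1 \<or> B = B2" if "block H B" "p i \<in> verts B" for B
      using *[OF that] B1 B2 block_unique_edge that(1) unfolding step_def by blast
    ultimately show ?thesis
      using B1 B2 by auto
  qed
  ultimately show "card {B. block H B \<and> p i \<in> verts B} = 2"
    by simp
qed

lemma cut_vertex_condition:
  assumes "cut_vertex H v"
  shows "card {B. block H B \<and> v \<in> verts B} = 2"
    and "block H B \<Longrightarrow> v \<in> verts B \<Longrightarrow> sink (walk_edges p n) B v"
proof -
  obtain i j where ij: "v = p i" "p i = p j" "i < j" "j < i + n"
    using cut_vertex_twice[OF assms] .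
  show "card {B. block H B \<and> v \<in> verts B} = 2"
    using blocks_twice(1)[OF ij(2-4)] ij(1) by simp
  assume B: "block H B" "v \<in> verts B"
  then consider "step i \<in> edges B" | "step j \<in> edges B"
    using blocks_twice(2)[OF ij(2-4)] ij(1) by blast
  then show "sink (walk_edges p n) B v"
  proof cases
    case 1
    then show ?thesis
      using sink_twice[OF ij(2-4) B(1)] ij(1) by simp
  next
    case 2
    then show ?thesis
      using sink_twice[of j "i + n", OF _ _ _ B(1)] ij periodic by simp
  qed
qed

text \<open>Running twice through an edge in the same direction would interleave the visits of its
  ends at \<open>k\<close>, \<open>Suc k\<close>, \<open>l\<close>, \<open>Suc l\<close>.\<close>

lemma no_repeated_direction:
  assumes "k < l" "l < k + n" "p k = p l" "p (Suc k) = p (Suc l)"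
  shows False
proof -
  have "l \<noteq> Suc k" "Suc l \<noteq> k + n"
    using no_loop[of k] no_loop[of l] periodic[of k] assms by auto
  then show False
    using noncrossing[of k l "Suc k" "Suc l"] assms by simp
qed

text \<open>The two passes have opposite directions, so they split the period into the times
  \<open>Suc k\<close> to \<open>l\<close> and \<open>Suc l\<close> to \<open>k + n\<close>. These
  pieces share no vertex, and only the steps \<open>k\<close> and \<open>l\<close> join
  them.\<close>

lemma repeated_step_cut_edge:
  assumes "k < l" "l < k + n" "step k = step l"
  shows "cut_edge H (step k)"
proof -
  have opp: "p k = p (Suc l)" "p (Suc k) = p l"
    using assms no_repeated_direction[OF assms(1,2)] by (auto simp: step_def doubleton_eq_iff)
  have disj: "p s \<noteq> p t" if s: "k < s" "s \<le> l" and t: "l < t" "t \<le> k + n" for s t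
  proof (cases "Suc l = k + n")
    case True
    \<comment> \<open>Here \<open>l - Suc k\<close> equals \<open>n - 2\<close>, an even gap between
      two visits of the same vertex; so the times coincide and the walk is one edge run back and
      forth.\<close>
    have "l = Suc k"
    proof (rule ccontr)
      assume "l \<noteq> Suc k"
      then have "odd (l - Suc k)"
        using visits_odd[OF opp(2)] assms by simp
      then show False
        using True even assms(1) by presburger
    qed
    then have "s = Suc k" "t = k + n"
      using s t True by auto
    then show ?thesis
      using no_loop[of k] periodic[of k] by simp
  next
    case False
    then have "Suc l < k + n"
      using assms by simp
    have "p s \<noteq> p k"
      using single_visit_between[OF opp(1) _ \<open>Suc l < k + n\<close>, of s] s by simp
    then show ?thesis
    proof (cases "t = Suc l \<or> t = k + n")
      case True
      then show ?thesis
        using \<open>p s \<noteq> p k\<close> opp(1) periodic[of k] by auto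
    next
      case False
      then show ?thesis
        using arcs_disjoint(1)[OF opp(1) s(1), of t] s t by simp
    qed
  qed
  have "(p (Suc k), p k) \<notin> (adj (edges H - {step k}))\<^sup>*"
  proof
    assume "(p (Suc k), p k) \<in> (adj (edges H - {step k}))\<^sup>*"
    then have "p k \<in> p ` {k<..l}"
    proof (rule adj_rtrancl_closed)
      fix a b assume ab: "{a, b} \<in> edges H - {step k}" "a \<in> p ` {k<..l}"
      from ab(2) obtain s where s: "a = p s" "k < s" "s \<le> l"
        by auto
      obtain m where m: "k \<le> m" "m < k + n" "{a, b} = step m"
        by (rule window_step[of "{a, b}" k]) (use ab(1) in \<open>simp_all add: edges_H\<close>)
      have "m \<noteq> k" "m \<noteq> l"
        using ab(1) m(3) assms(3) by auto
      then consider "k < m" "Suc m \<le> l" | "l < m" "Suc m \<le> k + n"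
        using m by linarith
      then show "b \<in> p ` {k<..l}"
      proof cases
        case 1
        then have "step m \<subseteq> p ` {k<..l}"
          by (auto simp: step_def)
        then show ?thesis
          using m(3) by blast
      next
        case 2
        have "a = p m \<or> a = p (Suc m)"
          using m(3) by (auto simp: step_def doubleton_eq_iff)
        then show ?thesis
          using disj[OF s(2,3), of m] disj[OF s(2,3), of "Suc m"] 2 s(1) by auto
      qed
    qed (use assms in auto)
    then obtain s where "p k = p s" "k < s" "s \<le> l"
      by auto
    then show False
      using disj[of s "k + n"] periodic[of k] assms by auto
  qed
  then show ?thesis
    unfolding cut_edge_iff[OF connected finite_verts] by (auto simp: edges_H verts_H)
qed

lemma multiple_edge_condition:
  assumes "multiple_edge (walk_edges p n) e"
  shows "double_edge (walk_edges p n) e" "cut_edge H e"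
proof -
  let ?S = "{k. k < n \<and> step k = e}"
  have gt: "card ?S > 1"
    using assms by (simp add: multiple_edge_def count_walk_edges)
  have "\<not> card ?S \<le> Suc 0"
    using gt by simp
  then have "\<exists>k\<in>?S. \<exists>l\<in>?S. k \<noteq> l"
    by (subst (asm) card_le_Suc0_iff_eq) auto
  then obtain a b where "a \<in> ?S" "b \<in> ?S" "a \<noteq> b"
    by blast
  then obtain k l where kl: "k \<in> ?S" "l \<in> ?S" "k < l"
    by (cases "a < b") (simp_all add: not_less)
  then show "cut_edge H e"
    using repeated_step_cut_edge[of k l] by auto
  \<comment> \<open>Since no direction repeats, an occurrence of \<open>e\<close> is determined by
    the end where it starts, and \<open>e\<close> has only two ends.\<close>
  have "inj_on p ?S"
  proof (rule linorder_inj_onI)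
    fix k l assume kl: "k < l" "k \<in> ?S" "l \<in> ?S"
    show "p k \<noteq> p l"
    proof
      assume "p k = p l"
      moreover have "step k = step l"
        using kl by simp
      ultimately have "p (Suc k) = p (Suc l)"
        unfolding step_def doubleton_eq_iff by metis
      then show False
        using no_repeated_direction[of k l] kl \<open>p k = p l\<close> by simp
    qed
  qed auto
  moreover have "p ` ?S \<subseteq> e" "finite e" "card e = 2"
    using kl(1) no_loop[of k] by (auto simp: step_def)
  ultimately have "card ?S \<le> 2"
    using card_mono[of e "p ` ?S"] card_image[of p ?S] by simp
  then show "double_edge (walk_edges p n) e"
    using gt by (simp add: double_edge_def count_walk_edges)
qed

text \<open>The times are chosen less than a period apart, so that \<open>step k = step l\<close>
  means a genuinely repeated edge and \<open>repeated_step_cut_edge\<close> applies.\<close>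

lemma block_incident_pair:
  assumes "block H B" "v \<in> verts B"
  obtains k l where "k < l" "l < k + n" "{e \<in> edges B. v \<in> e} = {step k, step l}"
proof -
  obtain i where i: "v = p i"
    using assms blockD(6)[OF assms(1)] by (auto simp: verts_H)
  show ?thesis
  proof (cases "\<exists>j. i < j \<and> j < i + n \<and> p i = p j")
    case True
    then obtain j where j: "i < j" "j < i + n" "p i = p j"
      by blast
    have sym: "p j = p (i + n)" "j < i + n" "i + n < j + n"
      using j periodic by simp_all
    have "Suc i \<noteq> j" "Suc j \<noteq> i + n"
      using no_loop[of i] no_loop[of j] j sym by auto
    then have lt: "i < j - 1" "j - 1 < i + n" "j < i + n - 1" "i + n - 1 < j + n"
      using j by auto
    consider "step i \<in> edges B" | "step j \<in> edges B"
      using blocks_twice(2)[OF j(3,1,2) assms(1)] i assms(2) by blast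
    then show ?thesis
    proof cases
      case 1
      show ?thesis
        by (rule that[OF lt(1,2)]) (simp add: i block_incident_twice[OF j(3,1,2) assms(1) 1])
    next
      case 2
      show ?thesis
        by (rule that[OF lt(3,4)]) (simp add: i j(3) block_incident_twice[OF sym assms(1) 2])
    qed
  next
    case False
    have "n \<noteq> 1"
      using even by auto
    then have n: "i < i + n - 1"
      using pos by simp
    have once: "p j \<noteq> p i" if "i < j" "j < i + n" for j
      using False that by metis
    have arc: "step i \<in> edges B \<longleftrightarrow> step (i + n - 1) \<in> edges B"
      by (rule arc_same_block[OF _ _ _ assms(1)]) (use once pos periodic[of i] in simp_all)
    have inc: "{e \<in> edges B. v \<in> e} \<subseteq> {step i, step (i + n - 1)}"
    proof
      fix e assume "e \<in> {e \<in> edges B. v \<in> e}"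
      then have "e \<in> edges H" "p i \<in> e"
        using i blockD(7)[OF assms(1)] by auto
      then show "e \<in> {step i, step (i + n - 1)}"
        using incident_step_once[of i e] once by blast
    qed
    obtain x where "{v, x} \<in> edges B"
      by (rule block_incident_edge[OF assms edges_nonempty])
    then have "{v, x} \<in> {e \<in> edges B. v \<in> e}"
      by simp
    with inc have "{v, x} = step i \<or> {v, x} = step (i + n - 1)"
      by blast
    with \<open>{v, x} \<in> edges B\<close> have "step i \<in> edges B" "step (i + n - 1) \<in> edges B"
      using arc by auto
    moreover have "v \<in> step i" "v \<in> step (i + n - 1)"
      using i pos periodic[of i] by (auto simp: step_def)
    ultimately have "{e \<in> edges B. v \<in> e} = {step i, step (i + n - 1)}"
      using inc by blast
    then show ?thesis
      using that[OF n] pos by simp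
  qed
qed

text \<open>No vertex has more than two edges in \<open>B\<close>. If one vertex has a single edge
  there, this edge is traversed twice and is all of \<open>B\<close>. Otherwise \<open>B\<close>
  contains a cycle that leaves room for no further edge.\<close>

lemma block_condition:
  assumes B: "block H B"
  shows "cycle_graph B \<or> (\<exists>e. cut_edge H e \<and> B = edge_graph e)"
proof -
  have "verts B \<noteq> {}"
    using blockD(5)[OF B] by (simp add: connected_graph_iff)
  then obtain v where v: "v \<in> verts B"
    by blast
  obtain k l where kl: "k < l" "l < k + n" "{e \<in> edges B. v \<in> e} = {step k, step l}"
    using block_incident_pair[OF B v] .
  show ?thesis
  proof (cases "step k = step l")
    case True
    define e where "e = step k"
    have inc: "{e \<in> edges B. v \<in> e} = {e}"
      using kl True by (simp add: e_def)
    then have "e \<in> edges B" "v \<in> e"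
      by auto
    then obtain x where x: "e = {v, x}" "x \<noteq> v" "x \<in> verts B"
      using edge_obtain_other[OF blockD(3)[OF B]] by metis
    \<comment> \<open>A third vertex would be cut off from \<open>v\<close> by deleting
      \<open>x\<close>, the only neighbour of \<open>v\<close> in \<open>B\<close>.\<close>
    have "verts B \<subseteq> {v, x}"
    proof
      fix y assume "y \<in> verts B"
      show "y \<in> {v, x}"
      proof (rule ccontr)
        assume "y \<notin> {v, x}"
        then have "(v, y) \<in> (adj {e \<in> edges B. x \<notin> e})\<^sup>*"
          using v \<open>y \<in> verts B\<close> x blockD(2-4)[OF B] biconnected_iff[of B] by blast
        then obtain z where "(v, z) \<in> adj {e \<in> edges B. x \<notin> e}"
          by (rule converse_rtranclE) (use \<open>y \<notin> {v, x}\<close> in auto)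
        then have "{v, z} \<in> {e \<in> edges B. v \<in> e}" "x \<notin> {v, z}"
          by simp_all
        then show False
          unfolding inc x(1) by simp
      qed
    qed
    then have vB: "verts B = e"
      using v x by auto
    have "f = e" if "f \<in> edges B" for f
    proof -
      have "f \<subseteq> {v, x}" "card f = 2"
        using that blockD(3)[OF B] vB x by (auto simp: simple_graph_def)
      then show ?thesis
        using x by (simp add: card_seteq)
    qed
    then have "edges B = {e}"
      using \<open>e \<in> edges B\<close> by blast
    then have "B = edge_graph e"
      using vB by (simp add: edge_graph_def prod_eq_iff)
    then show ?thesis
      using repeated_step_cut_edge[OF kl(1,2) True] by (auto simp: e_def)
  next
    case False
    have "step k \<in> edges B" "v \<in> step k" "step l \<in> edges B" "v \<in> step l"
      using kl(3) by blast+
    obtain x where x: "step k = {v, x}"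
      using \<open>step k \<in> edges B\<close> \<open>v \<in> step k\<close> by (rule edge_obtain_other[OF blockD(3)[OF B]])
    obtain y where y: "step l = {v, y}"
      using \<open>step l \<in> edges B\<close> \<open>v \<in> step l\<close> by (rule edge_obtain_other[OF blockD(3)[OF B]])
    have xy: "{v, x} \<in> edges B" "{v, y} \<in> edges B"
      using \<open>step k \<in> edges B\<close> \<open>step l \<in> edges B\<close> x y by simp_all
    have "x \<noteq> y"
      using False x y by auto
    have "{v, y} \<in> edges H"
      using xy blockD(7)[OF B] by auto
    obtain vs where vs: "distinct vs" "length vs \<ge> 3" "v \<in> set vs" "subgraph (cycle_on vs) B"
      by (rule block_cycle[OF B xy(1) \<open>{v, y} \<in> edges H\<close> \<open>x \<noteq> y\<close> block_edges_linked[OF B xy]])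
    have sub: "edges (cycle_on vs) \<subseteq> edges B" "set vs \<subseteq> verts B"
      using vs(4) by (auto simp: subgraph_def cycle_on_def)
    \<comment> \<open>The cycle already has two edges at \<open>u\<close>, as many as
      \<open>B\<close> can have, so all edges of \<open>B\<close> at \<open>u\<close> lie on the
      cycle.\<close>
    have inc: "{e \<in> edges B. u \<in> e} \<subseteq> edges (cycle_on vs)" if u: "u \<in> set vs" for u
    proof -
      obtain a b where ab: "a \<noteq> b" "{e \<in> edges (cycle_on vs). u \<in> e} = {{u, a}, {u, b}}"
        by (rule cycle_on_incident_edges[OF vs(1,2) u])
      obtain i j where ij: "{e \<in> edges B. u \<in> e} = {step i, step j}"
        by (rule block_incident_pair[OF B]) (use u sub in blast)
      have "{e \<in> edges (cycle_on vs). u \<in> e} \<subseteq> {e \<in> edges B. u \<in> e}"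
        using sub(1) by blast
      then have "{{u, a}, {u, b}} \<subseteq> {step i, step j}"
        unfolding ab(2) ij .
      moreover have "card {{u, a}, {u, b}} = 2"
        using ab(1) by (auto simp: doubleton_eq_iff)
      moreover have "card {step i, step j} \<le> 2"
        by (simp add: card_insert_if)
      ultimately have "{{u, a}, {u, b}} = {step i, step j}"
        by (intro card_seteq) simp_all
      then have "{e \<in> edges B. u \<in> e} = {e \<in> edges (cycle_on vs). u \<in> e}"
        unfolding ij ab(2) by (rule sym)
      then show ?thesis
        by blast
    qed
    have "verts B \<subseteq> set vs"
    proof
      fix y assume "y \<in> verts B"
      then have "(v, y) \<in> (adj (edges B))\<^sup>*"
        using v blockD(5)[OF B] by (simp add: connected_graph_iff)
      then show "y \<in> set vs"
      proof (rule adj_rtrancl_closed)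
        fix a b assume "{a, b} \<in> edges B" "a \<in> set vs"
        then have "{a, b} \<in> edges (cycle_on vs)"
          using inc[of a] by auto
        then show "b \<in> set vs"
          using simple_graph_cycle_on[OF vs(1,2)] by (auto simp: simple_graph_def cycle_on_def)
      qed (rule vs(3))
    qed
    moreover have "edges B \<subseteq> edges (cycle_on vs)"
    proof
      fix e assume e: "e \<in> edges B"
      then have "e \<subseteq> verts B" "card e = 2"
        using blockD(3)[OF B] by (auto simp: simple_graph_def)
      then obtain u where "u \<in> e" "u \<in> set vs"
        using \<open>verts B \<subseteq> set vs\<close> by (cases "e = {}") auto
      then show "e \<in> edges (cycle_on vs)"
        using inc e by blast
    qed
    ultimately have "B = cycle_on vs"
      using sub by (auto simp: prod_eq_iff cycle_on_def)
    then show ?thesis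
      using vs cycle_graph_iff by blast
  qed
qed

end

section \<open>Even closed subwalks\<close>

lemma size_filter_mset_disjoint:
  assumes "\<And>x. x \<in># M \<Longrightarrow> P x \<longleftrightarrow> Q x \<or> R x" "\<And>x. x \<in># M \<Longrightarrow> \<not> (Q x \<and> R x)"
  shows "size (filter_mset P M) = size (filter_mset Q M) + size (filter_mset R M)"
  using assms by (induction M) auto

lemma subseteq_mset_size_eq: "A \<subseteq># B \<Longrightarrow> size A = size B \<Longrightarrow> A = B"
  by (metis mset_subset_size nat_neq_iff subset_mset.le_less)

lemma size_filter_mset_nths:
  "size (filter_mset P (mset (nths xs A))) = card {k. k < length xs \<and> k \<in> A \<and> P (xs ! k)}"
proof (induction xs rule: rev_induct)
  case (snoc x xs)
  have "{k. k < length (xs @ [x]) \<and> k \<in> A \<and> P ((xs @ [x]) ! k)} =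
      {k. k < length xs \<and> k \<in> A \<and> P (xs ! k)} \<union> {k. k = length xs \<and> k \<in> A \<and> P x}" (is "_ = ?S \<union> ?T")
    by (auto simp: nth_append less_Suc_eq)
  moreover have "card (?S \<union> ?T) = card ?S + card ?T"
    by (intro card_Un_disjoint) auto
  moreover have "card ?T = (if length xs \<in> A \<and> P x then 1 else 0)"
    by (auto simp: card_1_singleton_iff)
  ultimately show ?case
    using snoc by (simp add: nths_append nths_singleton)
qed simp

lemma even_le_2: "even k \<Longrightarrow> k \<le> 2 \<Longrightarrow> k = 0 \<or> k = 2" for k :: nat
  by presburger

section \<open>Parity of crossings and balance at a vertex\<close>

definition crosses :: "'a set \<Rightarrow> 'a set \<Rightarrow> bool" where
  "crosses K e \<longleftrightarrow> e \<inter> K \<noteq> {} \<and> \<not> e \<subseteq> K"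

lemma walk_edges_Suc: "walk_edges p (Suc n) = walk_edges p n @ [{p n, p (Suc n)}]"
  by (simp add: walk_edges_def)

lemma even_crossings_iff:
  "even (size (filter_mset (crosses K) (mset (walk_edges p n)))) \<longleftrightarrow> (p 0 \<in> K \<longleftrightarrow> p n \<in> K)"
proof (induction n)
  case (Suc n)
  have "crosses K {p n, p (Suc n)} \<longleftrightarrow> (p n \<in> K \<longleftrightarrow> p (Suc n) \<notin> K)"
    by (auto simp: crosses_def)
  then show ?case
    using Suc by (simp add: walk_edges_Suc)
qed (simp add: walk_edges_def)

text \<open>Step \<open>k\<close> contributes \<open>(- 1) ^ k\<close> times the sum of the
  indicators of \<open>p k = v\<close> and \<open>p (Suc k) = v\<close>, and successive terms
  cancel. Distinct ends ensure that the sum of the indicators is the indicator of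
  \<open>v \<in> e\<close>.\<close>

lemma balance_telescope:
  assumes "\<And>k. k < n \<Longrightarrow> p k \<noteq> p (Suc k)"
  shows "int (size (filter_mset (\<lambda>e. v \<in> e) (E_plus (walk_edges p n)))) -
      int (size (filter_mset (\<lambda>e. v \<in> e) (E_minus (walk_edges p n)))) =
    of_bool (p 0 = v) - (- 1) ^ n * of_bool (p n = v)"
  using assms
proof (induction n)
  case (Suc n)
  have "p n \<noteq> p (Suc n)"
    using Suc.prems by simp
  then show ?case
    using Suc.IH[OF Suc.prems[OF less_SucI]] by (cases "even n") (auto simp: walk_edges_Suc E_plus_append E_minus_append)
qed (simp add: walk_edges_def)

lemma balance:
  assumes "even n" "p n = p 0" "\<And>k. k < n \<Longrightarrow> p k \<noteq> p (Suc k)"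
  shows "size (filter_mset (\<lambda>e. v \<in> e) (E_plus (walk_edges p n))) =
    size (filter_mset (\<lambda>e. v \<in> e) (E_minus (walk_edges p n)))"
  using balance_telescope[of n p v] assms by simp

text \<open>The degree of \<open>v\<close> in \<open>B\<close> counted by occurrences: a double edge
  contributes two, in agreement with \<open>sink\<close>.\<close>

definition degree_in :: "'a ugraph \<Rightarrow> 'a \<Rightarrow> 'a set multiset \<Rightarrow> nat" where
  "degree_in B v M = size (filter_mset (\<lambda>e. v \<in> e \<and> e \<in> edges B) M)"

lemma degree_in_mono: "M \<subseteq># N \<Longrightarrow> degree_in B v M \<le> degree_in B v N"
  by (simp add: degree_in_def multiset_filter_mono size_mset_mono)

lemma degree_in_add: "degree_in B v (M + N) = degree_in B v M + degree_in B v N"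
  by (simp add: degree_in_def)

lemma degree_in_pos:
  assumes "e \<in># M" "v \<in> e" "e \<in> edges B"
  shows "degree_in B v M > 0"
proof -
  have "e \<in># filter_mset (\<lambda>e. v \<in> e \<and> e \<in> edges B) M"
    using assms by simp
  then show ?thesis
    unfolding degree_in_def by (metis empty_iff gr0I set_mset_empty size_eq_0_iff_empty)
qed

lemma degree_in_eq_imp_count_eq:
  assumes "M \<subseteq># N" "degree_in B v M = degree_in B v N" "v \<in> e" "e \<in> edges B"
  shows "count M e = count N e"
proof -
  have *: "filter_mset (\<lambda>e. v \<in> e \<and> e \<in> edges B) M = filter_mset (\<lambda>e. v \<in> e \<and> e \<in> edges B) N"
    using assms(1,2) by (intro subseteq_mset_size_eq) (simp_all add: degree_in_def multiset_filter_mono)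
  show ?thesis
    using arg_cong[OF *, of "\<lambda>A. count A e"] assms(3,4) by simp
qed

lemma sink_degree_in:
  assumes "sink w B v"
  shows "degree_in B v (E_plus w) \<ge> 2 \<or> degree_in B v (E_minus w) \<ge> 2"
proof -
  obtain i j where ij: "i < length w" "j < length w" "i \<noteq> j" "even i \<longleftrightarrow> even j"
      "w ! i \<in> edges B" "w ! j \<in> edges B" "v \<in> w ! i" "v \<in> w ! j"
    using assms by (auto simp: sink_def)
  have *: "2 \<le> degree_in B v (mset (nths w A))" if "i \<in> A" "j \<in> A" for A
  proof -
    have "card {i, j} \<le> card {k. k < length w \<and> k \<in> A \<and> v \<in> w ! k \<and> w ! k \<in> edges B}"
      using ij that by (intro card_mono) auto
    then show ?thesis
      using ij(3) by (simp add: degree_in_def size_filter_mset_nths)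
  qed
  show ?thesis
    unfolding E_plus_def E_minus_def using ij(4) *[of "{k. even k}"] *[of "{k. odd k}"] by auto
qed

context finite_connected_graph
begin

lemma even_degree_in_block:
  assumes "block H B" "v \<in> verts B" "edges H \<noteq> {}"
    and "set (walk_edges p n) \<subseteq> edges H" "p n = p 0"
  shows "even (degree_in B v (mset (walk_edges p n)))"
proof -
  obtain x where x: "{v, x} \<in> edges B" "x \<noteq> v"
    by (rule block_incident_edge[OF assms(1-3)])
  \<comment> \<open>The edges of \<open>B\<close> at \<open>v\<close> are exactly the edges leaving this component of \<open>H - v\<close>.\<close>
  define K where "K = {y. (x, y) \<in> (adj {e \<in> edges H. v \<notin> e})\<^sup>*}"
  have "v \<notin> K"
  proof
    assume "v \<in> K"
    then obtain z where "(z, v) \<in> adj {e \<in> edges H. v \<notin> e}"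
      using x(2) by (auto simp: K_def elim: rtranclE)
    then show False
      by simp
  qed
  have "crosses K e \<longleftrightarrow> v \<in> e \<and> e \<in> edges B" if e: "e \<in> edges H" for e
  proof
    assume "crosses K e"
    then obtain a b where ab: "a \<in> e" "a \<in> K" "b \<in> e" "b \<notin> K"
      by (auto simp: crosses_def)
    moreover have "card e = 2"
      using e simple by (simp add: simple_graph_def)
    ultimately have "e = {a, b}"
      by (auto simp: card_2_iff)
    have "v \<in> e"
    proof (rule ccontr)
      assume "v \<notin> e"
      then have "(a, b) \<in> adj {e \<in> edges H. v \<notin> e}"
        using e \<open>e = {a, b}\<close> by simp
      then show False
        using ab by (auto simp: K_def intro: rtrancl_into_rtrancl)
    qed
    then have "e = {v, a}"
      using ab \<open>v \<notin> K\<close> \<open>e = {a, b}\<close> by auto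
    moreover have "(x, a) \<in> (adj {e \<in> edges H. v \<notin> e})\<^sup>*"
      using ab by (simp add: K_def)
    ultimately show "v \<in> e \<and> e \<in> edges B"
      using block_contains_linked_edge[OF assms(1) x(1), of a] e by simp
  next
    assume e: "v \<in> e \<and> e \<in> edges B"
    then obtain a where a: "e = {v, a}"
      using edge_obtain_other[OF blockD(3)[OF assms(1)]] by metis
    then have "a \<in> K"
      using block_edges_linked[OF assms(1) x(1)] e by (simp add: K_def)
    then show "crosses K e"
      using a \<open>v \<notin> K\<close> by (auto simp: crosses_def)
  qed
  then have "filter_mset (crosses K) (mset (walk_edges p n)) =
      filter_mset (\<lambda>e. v \<in> e \<and> e \<in> edges B) (mset (walk_edges p n))"
    using assms(4) by (intro filter_mset_cong) auto
  then show ?thesis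
    using even_crossings_iff[of K p n] assms(5) by (simp add: degree_in_def)
qed

text \<open>Every use of \<open>e\<close> on a path can be replaced by the rest of the
  cycle.\<close>

lemma cycle_edge_not_cut_edge:
  assumes "distinct vs" "length vs \<ge> 3" "edges (cycle_on vs) \<subseteq> edges H" "e \<in> edges (cycle_on vs)"
  shows "\<not> cut_edge H e"
proof -
  have "(x, y) \<in> (adj (edges H - {e}))\<^sup>*" if xy: "(x, y) \<in> (adj (edges H))\<^sup>*" for x y
    using xy
  proof (induction rule: rtrancl_induct)
    case (step y z)
    have "(y, z) \<in> (adj (edges H - {e}))\<^sup>*"
    proof (cases "{y, z} = e")
      case True
      then have "(y, z) \<in> (adj (edges (cycle_on vs) - {e}))\<^sup>*"
        using cycle_on_bypass_edge[OF assms(1,2), of y z] assms(4) by simp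
      then show ?thesis
        by (rule adj_rtrancl_mono) (use assms(3) in blast)
    next
      case False
      then have "(y, z) \<in> adj (edges H - {e})"
        using step by simp
      then show ?thesis
        by (rule r_into_rtrancl)
    qed
    then show ?case
      using step.IH by (rule rtrancl_trans[rotated])
  qed simp
  then show ?thesis
    using connected unfolding cut_edge_iff[OF connected finite_verts] connected_graph_iff by blast
qed

text \<open>Neighbours of \<open>v\<close> in the two blocks remain linked when \<open>v\<close> is
  deleted, so the local criterion puts an edge of \<open>C\<close> into \<open>B\<close>.\<close>

lemma non_cut_vertex_unique_block:
  assumes "\<not> cut_vertex H v" "block H B" "block H C" "v \<in> verts B" "v \<in> verts C" "edges H \<noteq> {}"
  shows "B = C"
proof -
  obtain x where x: "{v, x} \<in> edges B" "x \<noteq> v" "x \<in> verts B"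
    by (rule block_incident_edge[OF assms(2,4,6)])
  obtain y where y: "{v, y} \<in> edges C" "y \<noteq> v" "y \<in> verts C"
    by (rule block_incident_edge[OF assms(3,5,6)])
  have "v \<in> verts H" "x \<in> verts H" "y \<in> verts H"
    using x y assms(4) blockD(6)[OF assms(2)] blockD(6)[OF assms(3)] by blast+
  then have "(x, y) \<in> (adj {e \<in> edges H. v \<notin> e})\<^sup>*"
    using assms(1) x(2) y(2) unfolding cut_vertex_iff[OF connected finite_verts] by blast
  moreover have "{v, y} \<in> edges H"
    using y blockD(7)[OF assms(3)] by auto
  ultimately have "{v, y} \<in> edges B"
    using block_contains_linked_edge[OF assms(2) x(1)] by blast
  then show ?thesis
    using block_unique_edge[OF assms(2,3)] y by blast
qed

end

section \<open>Recovering the whole walk from an even closed subwalk\<close>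

context closed_walk
begin

lemma set_walk_edges: "set (walk_edges p n) = edges H"
  by (simp add: H_def walk_graph_def)

text \<open>The degree is even and positive, so a bound of 2 suffices. On a cycle there are two
  edges at \<open>v\<close>, each of multiplicity one because a multiple edge is a cut edge and
  cycle edges are not. In an edge block there is one edge, of multiplicity at most two.\<close>

lemma degree_in_block_eq_2:
  assumes blocks: "\<And>B. block H B \<Longrightarrow> cycle_graph B \<or> (\<exists>e. cut_edge H e \<and> B = edge_graph e)"
    and multiple: "\<And>e. multiple_edge (walk_edges p n) e \<Longrightarrow> double_edge (walk_edges p n) e \<and> cut_edge H e"
    and B: "block H B" "v \<in> verts B"
  shows "degree_in B v (mset (walk_edges p n)) = 2"
proof -
  let ?w = "mset (walk_edges p n)"
  have count2: "count ?w e \<le> 2" for e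
    using multiple[of e] by (cases "count ?w e > 1") (auto simp: multiple_edge_def double_edge_def)
  have "even (degree_in B v ?w)"
    using even_degree_in_block[OF B edges_nonempty] set_walk_edges periodic[of 0] by simp
  moreover obtain x where x: "{v, x} \<in> edges B"
    by (rule block_incident_edge[OF B edges_nonempty])
  then have "{v, x} \<in># ?w"
    using set_walk_edges blockD(7)[OF B(1)] by auto
  then have "degree_in B v ?w > 0"
    using x by (intro degree_in_pos) auto
  moreover have "degree_in B v ?w \<le> 2"
    using blocks[OF B(1)]
  proof
    assume "cycle_graph B"
    then obtain vs where vs: "distinct vs" "length vs \<ge> 3" "B = cycle_on vs"
      using cycle_graph_iff by blast
    have "v \<in> set vs"
      using B(2) vs(3) by (simp add: cycle_on_def)
    obtain a b where ab: "{e \<in> edges (cycle_on vs). v \<in> e} = {{v, a}, {v, b}}"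
      by (rule cycle_on_incident_edges[OF vs(1,2) \<open>v \<in> set vs\<close>])
    have le1: "count ?w e \<le> 1" if "e \<in> edges B" for e
    proof -
      have "\<not> cut_edge H e"
        using cycle_edge_not_cut_edge[OF vs(1,2), of e] that vs(3) blockD(7)[OF B(1)] by blast
      then have "\<not> multiple_edge (walk_edges p n) e"
        using multiple[of e] by blast
      then show ?thesis
        by (simp add: multiple_edge_def)
    qed
    have "v \<in> e \<and> e \<in> edges B \<longleftrightarrow> e = {v, a} \<or> e = {v, b}" for e
      using ab vs(3) by blast
    then have deg: "degree_in B v ?w = size (filter_mset (\<lambda>e. e = {v, a} \<or> e = {v, b}) ?w)"
      by (simp add: degree_in_def)
    have size_le: "size (filter_mset (\<lambda>e. e = f \<or> e = g) M) \<le> count M f + count M g"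
      for f g :: "'a set" and M
      by (induction M) auto
    have "{v, a} \<in> edges B" "{v, b} \<in> edges B"
      using ab vs(3) by blast+
    then show ?thesis
      using le1[of "{v, a}"] le1[of "{v, b}"] size_le[of "{v, a}" "{v, b}" ?w] deg by linarith
  next
    assume "\<exists>e. cut_edge H e \<and> B = edge_graph e"
    then obtain f where f: "B = edge_graph f"
      by blast
    have "size (filter_mset (\<lambda>e. v \<in> e \<and> e = f) M) \<le> size (filter_mset (\<lambda>e. e = f) M)" for M
      by (induction M) auto
    then have "degree_in B v ?w \<le> size (filter_mset (\<lambda>e. e = f) ?w)"
      by (simp add: degree_in_def f edge_graph_def)
    then show ?thesis
      using count2[of f] by (simp add: filter_eq_replicate_mset)
  qed
  ultimately show ?thesis
    using even_le_2[of "degree_in B v ?w"] by simp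
qed

text \<open>The length is determined without assuming it smaller than \<open>n\<close>; primitivity
  follows because \<open>length \<xi> < n\<close> is then impossible.\<close>

lemma no_smaller_even_closed_subwalk:
  assumes "even n"
    and blocks: "\<And>B. block H B \<Longrightarrow> cycle_graph B \<or> (\<exists>e. cut_edge H e \<and> B = edge_graph e)"
    and multiple: "\<And>e. multiple_edge (walk_edges p n) e \<Longrightarrow> double_edge (walk_edges p n) e \<and> cut_edge H e"
    and cut: "\<And>v. cut_vertex H v \<Longrightarrow> card {B. block H B \<and> v \<in> verts B} = 2 \<and>
       (\<forall>B. block H B \<and> v \<in> verts B \<longrightarrow> sink (walk_edges p n) B v)"
    and \<xi>: "even_closed_walk G \<xi>" "E_plus \<xi> \<subseteq># E_plus (walk_edges p n)" "E_minus \<xi> \<subseteq># E_minus (walk_edges p n)"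
  shows "length \<xi> = n"
proof -
  let ?w = "walk_edges p n"
  obtain q m where q: "\<xi> = walk_edges q m" "m > 0" "even m" "\<And>k. q (k + m) = q k"
    using \<xi>(1) by (rule even_closed_walkE) blast
  have q0: "q m = q 0"
    using q(4)[of 0] by simp
  have sub: "mset \<xi> \<subseteq># mset ?w"
    using \<xi>(2,3) by (simp add: mset_E_plus_E_minus subset_mset.add_mono)
  then have set_xi: "set \<xi> \<subseteq> edges H"
    using set_mset_mono[OF sub] set_walk_edges by simp
  have qloop: "q k \<noteq> q (Suc k)" if "k < m" for k
  proof -
    have "{q k, q (Suc k)} \<in> set \<xi>"
      using that by (auto simp: q(1) walk_edges_def)
    then show ?thesis
      using set_xi edgeD by blast
  qed
  have w2: "degree_in B v (mset ?w) = 2" if "block H B" "v \<in> verts B" for B v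
    using degree_in_block_eq_2[of B v] blocks multiple that by blast
  have 02: "degree_in B v (mset \<xi>) = 0 \<or> degree_in B v (mset \<xi>) = 2"
    if B: "block H B" "v \<in> verts B" for B v
  proof -
    have "even (degree_in B v (mset \<xi>))"
      using even_degree_in_block[OF B edges_nonempty] set_xi q0 by (simp add: q(1))
    moreover have "degree_in B v (mset \<xi>) \<le> 2"
      using degree_in_mono[OF sub, of B v] w2[OF B] by simp
    ultimately show ?thesis
      by (rule even_le_2)
  qed
  have same: "degree_in B v (mset \<xi>) = degree_in C v (mset \<xi>)"
    if B: "block H B" "v \<in> verts B" and C: "block H C" "v \<in> verts C" for B C v
  proof (cases "B = C \<or> \<not> cut_vertex H v")
    case True
    then show ?thesis
      using non_cut_vertex_unique_block[OF _ B(1) C(1) B(2) C(2) edges_nonempty] by blast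
  next
    case False
    then have card: "card {B. block H B \<and> v \<in> verts B} = 2"
      and sinks: "sink ?w B v" "sink ?w C v"
      using cut[of v] B C by blast+
    have all: "D = B \<or> D = C" if D: "block H D" "v \<in> verts D" for D
    proof -
      have "finite {B. block H B \<and> v \<in> verts B}"
        using card by (intro card_ge_0_finite) simp
      then have "{B, C} = {B. block H B \<and> v \<in> verts B}"
      proof (rule card_seteq)
        show "{B, C} \<subseteq> {B. block H B \<and> v \<in> verts B}"
          using B C by blast
        show "card {B. block H B \<and> v \<in> verts B} \<le> card {B, C}"
          using card False by simp
      qed
      then show ?thesis
        using D by blast
    qed
    \<comment> \<open>\<open>B\<close> and \<open>C\<close> are the only blocks at \<open>v\<close>
      and share no edge, so they partition the edges at \<open>v\<close>; the vertex balance becomes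
      an equation between degrees in the two blocks.\<close>
    have split: "size (filter_mset (\<lambda>e. v \<in> e) M) = degree_in B v M + degree_in C v M"
      if M: "set_mset M \<subseteq> edges H" for M
      unfolding degree_in_def
    proof (rule size_filter_mset_disjoint)
      fix e assume "e \<in># M"
      then have e: "e \<in> edges H"
        using M by blast
      show "v \<in> e \<longleftrightarrow> v \<in> e \<and> e \<in> edges B \<or> v \<in> e \<and> e \<in> edges C"
      proof
        assume "v \<in> e"
        then obtain x where x: "e = {v, x}"
          by (rule edge_obtain_other[OF simple e])
        obtain D where D: "block H D" "{v, x} \<in> edges D"
          by (rule edge_in_block[of v x]) (use e x in simp)
        then have "D = B \<or> D = C"
          using all block_edgeD by blast
        then show "v \<in> e \<and> e \<in> edges B \<or> v \<in> e \<and> e \<in> edges C"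
          using D x by auto
      qed auto
      show "\<not> ((v \<in> e \<and> e \<in> edges B) \<and> (v \<in> e \<and> e \<in> edges C))"
      proof
        assume *: "(v \<in> e \<and> e \<in> edges B) \<and> (v \<in> e \<and> e \<in> edges C)"
        obtain x where "e = {v, x}"
          by (rule edge_obtain_other[OF simple e]) (use * in blast)
        then show False
          using block_unique_edge[OF B(1) C(1), of v x] * False by simp
      qed
    qed
    have parts: "set_mset (E_plus ?w) \<subseteq> edges H" "set_mset (E_minus ?w) \<subseteq> edges H"
      "set_mset (E_plus \<xi>) \<subseteq> edges H" "set_mset (E_minus \<xi>) \<subseteq> edges H"
      using set_walk_edges set_xi mset_E_plus_E_minus[of ?w] mset_E_plus_E_minus[of \<xi>]
      by (metis Un_subset_iff order_refl set_mset_mset set_mset_union)+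
    have "degree_in B v (E_plus ?w) + degree_in C v (E_plus ?w) =
        degree_in B v (E_minus ?w) + degree_in C v (E_minus ?w)"
      using balance[OF assms(1), of p v] periodic[of 0] no_loop split parts by simp
    moreover have "degree_in B v (E_plus \<xi>) + degree_in C v (E_plus \<xi>) =
        degree_in B v (E_minus \<xi>) + degree_in C v (E_minus \<xi>)"
      using balance[OF q(3) q0 qloop, of v] split parts unfolding q(1) by simp
    moreover have "degree_in B v (E_plus ?w) + degree_in B v (E_minus ?w) = 2"
      "degree_in C v (E_plus ?w) + degree_in C v (E_minus ?w) = 2"
      using w2[OF B] w2[OF C] by (simp_all add: mset_E_plus_E_minus degree_in_add)
    moreover have "degree_in B v (E_plus ?w) \<ge> 2 \<or> degree_in B v (E_minus ?w) \<ge> 2"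
      "degree_in C v (E_plus ?w) \<ge> 2 \<or> degree_in C v (E_minus ?w) \<ge> 2"
      by (rule sinks[THEN sink_degree_in])+
    moreover have "degree_in B v (E_plus \<xi>) \<le> degree_in B v (E_plus ?w)"
      "degree_in B v (E_minus \<xi>) \<le> degree_in B v (E_minus ?w)"
      "degree_in C v (E_plus \<xi>) \<le> degree_in C v (E_plus ?w)"
      "degree_in C v (E_minus \<xi>) \<le> degree_in C v (E_minus ?w)"
      using \<xi>(2,3) by (simp_all add: degree_in_mono)
    \<comment> \<open>By the sink condition both occurrences of \<open>w\<close> in \<open>B\<close>
      at \<open>v\<close> have one parity; balance of \<open>w\<close> gives both occurrences in
      \<open>C\<close> the other. So \<open>\<xi>\<close> lives on one side in \<open>B\<close> and
      on the opposite side in \<open>C\<close>, and its own balance equates the two degrees.\<close>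
    ultimately have "degree_in B v (E_plus \<xi>) + degree_in B v (E_minus \<xi>) =
        degree_in C v (E_plus \<xi>) + degree_in C v (E_minus \<xi>)"
      by - (elim disjE; linarith)
    then show ?thesis
      by (simp add: mset_E_plus_E_minus degree_in_add)
  qed
  \<comment> \<open>The vertices met by \<open>\<xi>\<close>. Full use of every edge at such a
    vertex makes this set closed under adjacency, hence all of \<open>H\<close> by
    connectedness.\<close>
  define T where "T = {v. \<exists>e \<in># mset \<xi>. v \<in> e}"
  have count_eq: "count (mset \<xi>) e = count (mset ?w) e" if e: "v \<in> T" "v \<in> e" "e \<in> edges H" for v e
  proof -
    obtain f where f: "f \<in># mset \<xi>" "v \<in> f"
      using e(1) by (auto simp: T_def)
    have fH: "f \<in> edges H"
      using f set_xi by auto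
    obtain x where x: "f = {v, x}"
      by (rule edge_obtain_other[OF simple fH f(2)])
    obtain y where y: "e = {v, y}"
      by (rule edge_obtain_other[OF simple e(3,2)])
    obtain B where B: "block H B" "f \<in> edges B"
      by (rule edge_in_block[of v x]) (use fH x in simp_all)
    obtain C where C: "block H C" "e \<in> edges C"
      by (rule edge_in_block[of v y]) (use e(3) y in simp_all)
    have vB: "v \<in> verts B" "v \<in> verts C"
      using block_edgeD(1)[OF B(1), of v x] block_edgeD(1)[OF C(1), of v y] B(2) C(2) x y
      by simp_all
    \<comment> \<open>One edge of \<open>\<xi>\<close> at \<open>v\<close> forces degree 2 in its
      block and then, by \<open>same\<close>, in every block at \<open>v\<close>. That is the full
      degree in \<open>w\<close>, so no occurrence of \<open>e\<close> can be missing.\<close>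
    have "degree_in B v (mset \<xi>) > 0"
      using f B by (intro degree_in_pos)
    then have "degree_in C v (mset \<xi>) = 2"
      using 02[OF B(1) vB(1)] same[OF B(1) vB(1) C(1) vB(2)] by simp
    then show ?thesis
      using degree_in_eq_imp_count_eq[OF sub _ e(2) C(2)] w2[OF C(1) vB(2)] by simp
  qed
  have mem: "e \<in># mset \<xi>" if "v \<in> T" "v \<in> e" "e \<in> edges H" for v e
    using count_eq[OF that] that(3) set_walk_edges by (metis count_eq_zero_iff set_mset_mset)
  have q0T: "q 0 \<in> T" "q 0 \<in> verts H"
  proof -
    have "{q 0, q (Suc 0)} \<in> set \<xi>"
      using q(2) by (force simp: q(1) walk_edges_def)
    then show "q 0 \<in> T" "q 0 \<in> verts H"
      using set_xi edgeD by (auto simp: T_def)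
  qed
  have "y \<in> T" if "y \<in> verts H" for y
  proof -
    have "(q 0, y) \<in> (adj (edges H))\<^sup>*"
      using connected q0T(2) that by (simp add: connected_graph_iff)
    then show ?thesis
    proof (rule adj_rtrancl_closed)
      fix a b assume "{a, b} \<in> edges H" "a \<in> T"
      then have "{a, b} \<in># mset \<xi>"
        using mem by blast
      then show "b \<in> T"
        unfolding T_def by blast
    qed (rule q0T(1))
  qed
  then have "count (mset \<xi>) e = count (mset ?w) e" for e
  proof (cases "e \<in> edges H")
    case True
    then have "card e = 2" "e \<subseteq> verts H"
      using simple by (auto simp: simple_graph_def)
    then obtain v where "v \<in> e" "v \<in> verts H"
      by (cases "e = {}") auto
    then show ?thesis
      using count_eq True \<open>\<And>y. y \<in> verts H \<Longrightarrow> y \<in> T\<close> by blast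
  next
    case False
    then have "e \<notin># mset \<xi>" "e \<notin># mset ?w"
      using set_xi set_walk_edges by auto
    then show ?thesis
      by (simp only: count_eq_zero_iff[symmetric])
  qed
  then have "mset \<xi> = mset ?w"
    by (rule multiset_eqI)
  then show ?thesis
    using mset_eq_length by fastforce
qed

end

theorem theorem3p1:
  fixes G :: "'a ugraph" and w :: "'a set list"
  assumes "finite (verts G)" and "simple_graph G" and "connected_graph G"
    and "even_closed_walk G w"
  shows "primitive G w \<longleftrightarrow>
    (\<forall>B. block (walk_graph w) B \<longrightarrow>
       cycle_graph B \<or> (\<exists>e. cut_edge (walk_graph w) e \<and> B = edge_graph e)) \<and>
    (\<forall>e. multiple_edge w e \<longrightarrow> double_edge w e \<and> cut_edge (walk_graph w) e) \<and>
    (\<forall>v. cut_vertex (walk_graph w) v \<longrightarrow>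
       card {B. block (walk_graph w) B \<and> v \<in> verts B} = 2 \<and>
       (\<forall>B. block (walk_graph w) B \<and> v \<in> verts B \<longrightarrow> sink w B v))"
    (is "_ \<longleftrightarrow> ?blocks \<and> ?multiple \<and> ?cut")
proof -
  obtain p n where w: "w = walk_edges p n" and n: "n > 0" "even n"
    and periodic: "\<And>k. p (k + n) = p k" and sub: "set w \<subseteq> edges G"
    using assms(4) by (rule even_closed_walkE) blast
  have no_loop: "p k \<noteq> p (Suc k)" if "k < n" for k
  proof -
    have "{p k, p (Suc k)} \<in> edges G"
      using sub that by (auto simp: w walk_edges_def)
    then show ?thesis
      using assms(2) by (force simp: simple_graph_def)
  qed
  interpret closed_walk p n
    by (rule closed_walk.intro) (rule n(1) periodic no_loop, assumption?)+
  have H: "walk_graph w = H"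
    by (simp add: H_def w)
  show ?thesis
  proof
    assume prim: "primitive G w"
    interpret noncrossing_walk p n
    proof
      show "odd (j - i)" if "p i = p j" "i < j" "j < i + n" for i j
        using primitive_visits_odd[OF prim[unfolded w] periodic] that by blast
      show False if "p i = p j" "p k = p l" "i < k" "k < j" "j < l" "l < i + n" for i j k l
        using primitive_noncrossing[OF prim[unfolded w] periodic] that by blast
    qed (rule n(2))
    show "?blocks \<and> ?multiple \<and> ?cut"
      unfolding H unfolding w
      using block_condition multiple_edge_condition cut_vertex_condition by blast
  next
    assume conditions: "?blocks \<and> ?multiple \<and> ?cut"
    note conditions' = conditions[unfolded H, unfolded w]
    have "length \<xi> = n"
      if "even_closed_walk G \<xi>" "E_plus \<xi> \<subseteq># E_plus w" "E_minus \<xi> \<subseteq># E_minus w" for \<xi>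
    proof (rule no_smaller_even_closed_subwalk[OF n(2) _ _ _ that[unfolded w]])
      show "cycle_graph B \<or> (\<exists>e. cut_edge H e \<and> B = edge_graph e)" if "block H B" for B
        using conditions' that by blast
      show "double_edge (walk_edges p n) e \<and> cut_edge H e" if "multiple_edge (walk_edges p n) e" for e
        using conditions' that by blast
      show "card {B. block H B \<and> v \<in> verts B} = 2 \<and>
          (\<forall>B. block H B \<and> v \<in> verts B \<longrightarrow> sink (walk_edges p n) B v)" if "cut_vertex H v" for v
        using conditions' that by blast
    qed
    then show "primitive G w"
      using assms(4) w by (auto simp: primitive_def)
  qed
qed

end
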